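(* Let $G$ be a finite group with $d(G)\geq 1/3$. Then $G$ is either supersolvable or isoclinic to $A_4$.
   Context: For a finite group $G$, $d(G) := \frac{1}{|G|^2}\,|\{(x,y)\in G\times G \mid xy=yx\}|$ is the commuting probability of $G$; equivalently $d(G)=k(G)/|G|$, where $k(G)$ is the number of conjugacy classes of $G$. $\mathbf{Z}(G)$ denotes the center of $G$, $G'$ the commutator (derived) subgroup, and $A_4$ the alternating group of degree 4. Two groups $G$ and $H$ are isoclinic if there are isomorphisms $\varphi: G/\mathbf{Z}(G)\to H/\mathbf{Z}(H)$ and $\phi: G'\to H'$ such that whenever $\varphi(g_1\mathbf{Z}(G))=h_1\mathbf{Z}(H)$ and $\varphi(g_2\mathbf{Z}(G))=h_2\mathbf{Z}(H)$, one has $\phi([g_1,g_2])=[h_1,h_2]$. *)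

theory Defs
  imports Complex_Main "HOL-Algebra.Sym_Groups" "HOL-Algebra.Elementary_Groups"
begin

definition commuting_probability :: "('a, 'b) monoid_scheme \<Rightarrow> real" where
  "commuting_probability G =
     real (card {(x, y). x \<in> carrier G \<and> y \<in> carrier G \<and> x \<otimes>\<^bsub>G\<^esub> y = y \<otimes>\<^bsub>G\<^esub> x})
       / (real (order G))\<^sup>2"

definition group_center :: "('a, 'b) monoid_scheme \<Rightarrow> 'a set" where
  "group_center G = {z \<in> carrier G. \<forall>x \<in> carrier G. z \<otimes>\<^bsub>G\<^esub> x = x \<otimes>\<^bsub>G\<^esub> z}"

text \<open>The convention [x, y] = x y x^-1 y^-1 is the one used in \<^const>\<open>derived\<close>.\<close>

definition commutator :: "('a, 'b) monoid_scheme \<Rightarrow> 'a \<Rightarrow> 'a \<Rightarrow> 'a" where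
  "commutator G x y = x \<otimes>\<^bsub>G\<^esub> y \<otimes>\<^bsub>G\<^esub> inv\<^bsub>G\<^esub> x \<otimes>\<^bsub>G\<^esub> inv\<^bsub>G\<^esub> y"

text \<open>Every term of the series is normal in the whole group, not only in the next term.\<close>

definition supersolvable :: "('a, 'b) monoid_scheme \<Rightarrow> bool" where
  "supersolvable G \<longleftrightarrow>
     (\<exists>(n :: nat) (N :: nat \<Rightarrow> 'a set).
        N 0 = {\<one>\<^bsub>G\<^esub>} \<and> N n = carrier G \<and>
        (\<forall>i \<le> n. N i \<lhd> G) \<and>
        (\<forall>i < n. N i \<subseteq> N (Suc i) \<and>
                 cyclic_group ((G\<lparr>carrier := N (Suc i)\<rparr>) Mod (N i))))"

definition isoclinic :: "('a, 'c) monoid_scheme \<Rightarrow> ('b, 'd) monoid_scheme \<Rightarrow> bool" where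
  "isoclinic G H \<longleftrightarrow>
     (\<exists>\<phi> \<psi>.
        \<phi> \<in> iso (G Mod group_center G) (H Mod group_center H) \<and>
        \<psi> \<in> iso (G\<lparr>carrier := derived G (carrier G)\<rparr>) (H\<lparr>carrier := derived H (carrier H)\<rparr>) \<and>
        (\<forall>g1 \<in> carrier G. \<forall>g2 \<in> carrier G. \<forall>h1 \<in> carrier H. \<forall>h2 \<in> carrier H.
           \<phi> (group_center G #>\<^bsub>G\<^esub> g1) = group_center H #>\<^bsub>H\<^esub> h1 \<longrightarrow>
           \<phi> (group_center G #>\<^bsub>G\<^esub> g2) = group_center H #>\<^bsub>H\<^esub> h2 \<longrightarrow>
           \<psi> (commutator G g1 g2) = commutator H h1 h2))"

end

theory Submission
  imports Defs "HOL-Algebra.Group_Action"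
begin

text \<open>Let \<open>N\<close> be a maximal normal subgroup of \<open>G\<close> that is reached from 1 by a series of normal subgroups of \<open>G\<close>
  with cyclic factors, and \<open>Q = G/N\<close>. If \<open>Q\<close> is trivial, then \<open>G\<close> is supersolvable. Otherwise a nontrivial
  element of \<open>Q\<close> with at most 2 conjugates would yield a nontrivial cyclic normal subgroup of \<open>Q\<close>, so all
  nontrivial classes of \<open>Q\<close> have at least 3 elements. Moreover \<open>d(Q) \<ge> d(G) \<ge> 1/3\<close>, so at most 8
  nontrivial elements of \<open>Q\<close> have more than 3 conjugates. Let \<open>K\<close> be the kernel of the action of \<open>Q\<close> on a
  class of size 3 and \<open>R\<close> the set of elements acting without fixed points; then \<open>|R| = 2|K|\<close> and \<open>K\<close>
  contains the class. No nontrivial element commutes with \<open>K\<close> and with an element of \<open>R\<close>, so the elements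
  of \<open>R\<close> have at least 4 conjugates. Hence \<open>|K| = 4\<close>, \<open>Q = K \<union> R\<close> has order 12 and is isomorphic to the
  alternating group, and \<open>d(Q) = 1/3\<close>. Then \<open>d(G) = d(Q)\<close>, which means that elements of \<open>G\<close>
  commute as soon as their images in \<open>Q\<close> do; this makes \<open>G \<rightarrow> Q\<close> an isoclinism.\<close>

section \<open>Conjugation and centralizers\<close>

context group
begin

definition conjugate :: "'a \<Rightarrow> 'a \<Rightarrow> 'a"
  where "conjugate g x = g \<otimes> x \<otimes> inv g"

definition centralizer :: "'a \<Rightarrow> 'a set"
  where "centralizer x = {g \<in> carrier G. g \<otimes> x = x \<otimes> g}"

definition conjugacy_class :: "'a \<Rightarrow> 'a set"
  where "conjugacy_class x = (\<lambda>g. conjugate g x) ` carrier G"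

definition commuting_pairs :: "('a \<times> 'a) set"
  where "commuting_pairs = {(x, y). x \<in> carrier G \<and> y \<in> carrier G \<and> x \<otimes> y = y \<otimes> x}"

lemma conjugate_closed [simp]:
  "g \<in> carrier G \<Longrightarrow> x \<in> carrier G \<Longrightarrow> conjugate g x \<in> carrier G"
  by (simp add: conjugate_def)

lemma conjugate_one_left [simp]: "x \<in> carrier G \<Longrightarrow> conjugate \<one> x = x"
  by (simp add: conjugate_def)

lemma conjugate_one_right [simp]: "g \<in> carrier G \<Longrightarrow> conjugate g \<one> = \<one>"
  by (simp add: conjugate_def)

lemma conjugate_mult_left:
  assumes "g \<in> carrier G" "h \<in> carrier G" "x \<in> carrier G"
  shows "conjugate (g \<otimes> h) x = conjugate g (conjugate h x)"
  using assms by (simp add: conjugate_def m_assoc inv_mult_group)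

lemma conjugate_mult_right:
  assumes "g \<in> carrier G" "x \<in> carrier G" "y \<in> carrier G"
  shows "conjugate g (x \<otimes> y) = conjugate g x \<otimes> conjugate g y"
proof -
  have "inv g \<otimes> (g \<otimes> (y \<otimes> inv g)) = y \<otimes> inv g"
    using assms by (simp flip: m_assoc)
  then show ?thesis using assms by (simp add: conjugate_def m_assoc)
qed

lemma conjugate_inv:
  assumes "g \<in> carrier G" "x \<in> carrier G"
  shows "conjugate g (inv x) = inv (conjugate g x)"
  using assms by (simp add: conjugate_def m_assoc inv_mult_group)

lemma conjugate_inv_cancel [simp]:
  assumes "g \<in> carrier G" "x \<in> carrier G"
  shows "conjugate (inv g) (conjugate g x) = x" "conjugate g (conjugate (inv g) x) = x"
  using assms by (simp_all flip: conjugate_mult_left)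

lemma conjugate_eq_iff [simp]:
  assumes "g \<in> carrier G" "x \<in> carrier G" "y \<in> carrier G"
  shows "conjugate g x = conjugate g y \<longleftrightarrow> x = y"
  using assms conjugate_inv_cancel(1) by metis

lemma conjugate_eq_self_iff:
  assumes "g \<in> carrier G" "x \<in> carrier G"
  shows "conjugate g x = x \<longleftrightarrow> g \<otimes> x = x \<otimes> g"
  using assms by (metis conjugate_def inv_closed inv_solve_right m_closed)

lemma mem_centralizer_iff:
  "x \<in> carrier G \<Longrightarrow> g \<in> centralizer x \<longleftrightarrow> g \<in> carrier G \<and> conjugate g x = x"
  by (auto simp: centralizer_def conjugate_eq_self_iff)

lemma centralizer_sym:
  "x \<in> carrier G \<Longrightarrow> y \<in> centralizer x \<Longrightarrow> x \<in> centralizer y"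
  by (auto simp: centralizer_def)

lemma centralizer_subset: "centralizer x \<subseteq> carrier G"
  by (auto simp: centralizer_def)

lemma subgroup_centralizer:
  assumes "x \<in> carrier G"
  shows "subgroup (centralizer x) G"
proof (rule subgroupI)
  show "centralizer x \<subseteq> carrier G" by (rule centralizer_subset)
  show "centralizer x \<noteq> {}" using assms by (auto simp: centralizer_def)
  show "inv g \<in> centralizer x" if "g \<in> centralizer x" for g
    using that assms conjugate_inv_cancel(1)[of g x] by (auto simp: mem_centralizer_iff)
  show "g \<otimes> h \<in> centralizer x" if "g \<in> centralizer x" "h \<in> centralizer x" for g h
    using that assms by (auto simp: mem_centralizer_iff conjugate_mult_left)
qed

lemma card_conjugacy_class:
  assumes "x \<in> carrier G"
  shows "card (conjugacy_class x) * card (centralizer x) = order G"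
proof -
  let ?\<phi> = "\<lambda>g. \<lambda>h \<in> carrier G. g \<otimes> h \<otimes> inv g"
  interpret group_action G "carrier G" ?\<phi> by (rule action_by_conjugation)
  have "orbit G ?\<phi> x = conjugacy_class x"
    using assms by (auto simp: orbit_def conjugacy_class_def conjugate_def)
  moreover have "stabilizer G ?\<phi> x = centralizer x"
    using assms by (auto simp: stabilizer_def mem_centralizer_iff conjugate_def)
  ultimately show ?thesis using orbit_stabilizer_theorem[OF assms] by simp
qed

lemma conjugacy_class_self: "x \<in> carrier G \<Longrightarrow> x \<in> conjugacy_class x"
  unfolding conjugacy_class_def by (metis conjugate_one_left image_eqI one_closed)

lemma conjugacy_class_subset: "x \<in> carrier G \<Longrightarrow> conjugacy_class x \<subseteq> carrier G"
  by (auto simp: conjugacy_class_def)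

lemma conjugate_mem_conjugacy_class:
  assumes "g \<in> carrier G" "x \<in> carrier G" "y \<in> conjugacy_class x"
  shows "conjugate g y \<in> conjugacy_class x"
  using assms by (auto simp: conjugacy_class_def simp flip: conjugate_mult_left)

lemma conjugacy_class_eq:
  assumes "x \<in> carrier G" "y \<in> conjugacy_class x"
  shows "conjugacy_class y = conjugacy_class x"
proof -
  obtain g where g: "g \<in> carrier G" "y = conjugate g x"
    using assms(2) by (auto simp: conjugacy_class_def)
  have "conjugate h x \<in> conjugacy_class y" if "h \<in> carrier G" for h
  proof -
    have "conjugate h x = conjugate (h \<otimes> inv g) y"
      using g assms(1) that by (simp add: conjugate_mult_left)
    then show ?thesis using g that by (simp add: conjugacy_class_def)
  qed
  moreover have "conjugate h y \<in> conjugacy_class x" if "h \<in> carrier G" for h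
    using conjugate_mem_conjugacy_class that assms by blast
  ultimately show ?thesis by (auto simp: conjugacy_class_def)
qed

lemma card_commuting_pairs:
  assumes "finite (carrier G)"
  shows "card commuting_pairs = (\<Sum>x\<in>carrier G. card (centralizer x))"
proof -
  have "commuting_pairs = (SIGMA x:carrier G. centralizer x)"
    by (auto simp: commuting_pairs_def centralizer_def)
  then show ?thesis
    using assms finite_subset[OF centralizer_subset] by (simp add: card_SigmaI)
qed

end

section \<open>Groups with small centralizers\<close>

context group
begin

definition class_kernel :: "'a \<Rightarrow> 'a set"
  where "class_kernel x = {g \<in> carrier G. \<forall>y \<in> conjugacy_class x. conjugate g y = y}"

definition class_derangements :: "'a \<Rightarrow> 'a set"
  where "class_derangements x = {g \<in> carrier G. \<forall>y \<in> conjugacy_class x. conjugate g y \<noteq> y}"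

lemma class_kernel_subset: "class_kernel x \<subseteq> carrier G"
  by (auto simp: class_kernel_def)

lemma class_derangements_subset: "class_derangements x \<subseteq> carrier G"
  by (auto simp: class_derangements_def)

lemma normal_class_kernel:
  assumes x: "x \<in> carrier G"
  shows "class_kernel x \<lhd> G"
proof (rule normal_invI)
  note cl = conjugacy_class_subset[OF x, THEN subsetD]
  show "subgroup (class_kernel x) G"
  proof (rule subgroupI)
    show "class_kernel x \<subseteq> carrier G" by (rule class_kernel_subset)
    have "\<one> \<in> class_kernel x" using cl by (auto simp: class_kernel_def)
    then show "class_kernel x \<noteq> {}" by auto
    show "inv g \<in> class_kernel x" if "g \<in> class_kernel x" for g
    proof -
      have "conjugate (inv g) y = y" if "y \<in> conjugacy_class x" for y
        using \<open>g \<in> class_kernel x\<close> that cl[OF that] conjugate_inv_cancel(1)[of g y]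
        by (auto simp: class_kernel_def)
      then show ?thesis using that by (auto simp: class_kernel_def)
    qed
    show "g \<otimes> h \<in> class_kernel x" if "g \<in> class_kernel x" "h \<in> class_kernel x" for g h
      using that cl by (auto simp: class_kernel_def conjugate_mult_left)
  qed
  show "g \<otimes> h \<otimes> inv g \<in> class_kernel x" if g: "g \<in> carrier G" and h: "h \<in> class_kernel x" for g h
  proof -
    have hc: "h \<in> carrier G" using h by (simp add: class_kernel_def)
    have "conjugate (g \<otimes> h \<otimes> inv g) y = y" if y: "y \<in> conjugacy_class x" for y
    proof -
      have "conjugate (inv g) y \<in> conjugacy_class x"
        using conjugate_mem_conjugacy_class g x y by blast
      then have "conjugate h (conjugate (inv g) y) = conjugate (inv g) y"
        using h by (simp add: class_kernel_def)
      then show ?thesis using g hc cl[OF y] by (simp add: conjugate_mult_left)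
    qed
    then show ?thesis using g hc by (simp add: class_kernel_def)
  qed
qed

lemma commute_class_kernel:
  assumes "x \<in> carrier G" "g \<in> class_kernel x" "y \<in> conjugacy_class x"
  shows "g \<in> centralizer y"
proof -
  have "y \<in> carrier G" using conjugacy_class_subset[OF assms(1)] assms(3) by blast
  with assms show ?thesis by (simp add: class_kernel_def mem_centralizer_iff)
qed

end

text \<open>By orbit-stabilizer, \<open>card_centralizer_le\<close> says that every nontrivial class
  has at least 3 elements, and \<open>order_square_le\<close> says that the commuting probability is
  at least 1/3. Both are stated over the naturals, without division.\<close>

locale small_centralizers = group G for G (structure) +
  assumes finite_carrier: "finite (carrier G)"
    and card_centralizer_le:
      "y \<in> carrier G \<Longrightarrow> y \<noteq> \<one> \<Longrightarrow> 3 * card (centralizer y) \<le> order G"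
    and order_square_le: "(order G)\<^sup>2 \<le> 3 * card commuting_pairs"
begin

text \<open>Again by orbit-stabilizer, these are the nontrivial elements with at least 4
  conjugates.\<close>

definition large_class_elements :: "'a set"
  where "large_class_elements = {y \<in> carrier G. y \<noteq> \<one> \<and> 4 * card (centralizer y) \<le> order G}"

lemma order_pos: "0 < order G"
  using finite_carrier by (simp add: order_gt_0_iff_finite)

text \<open>The commuting pairs are counted by summing centralizer orders. With \<open>n\<close> the
  group order, a centralizer has order at most \<open>n\<close> for the identity, \<open>n/4\<close>
  for elements of large classes and \<open>n/3\<close> for the others; the factor 12 clears both
  denominators.\<close>

lemma twelve_card_commuting_pairs_le:
  "12 * card commuting_pairs + order G * card large_class_elements \<le> 4 * (order G)\<^sup>2 + 8 * order G"
proof -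
  let ?n = "order G" and ?E = large_class_elements
  \<comment> \<open>The weight \<open>?w y\<close> bounds 12 times the order of the centralizer of
    \<open>y\<close>.\<close>
  let ?w = "\<lambda>y. if y = \<one> then 12 * ?n else if y \<in> ?E then 3 * ?n else 4 * ?n"
  have E: "?E \<subseteq> carrier G - {\<one>}" by (auto simp: large_class_elements_def)
  then have fin: "finite ?E" using finite_carrier finite_subset by blast
  have "12 * card (centralizer y) \<le> ?w y" if "y \<in> carrier G" for y
  proof (cases "y = \<one>")
    case True
    then have "card (centralizer y) \<le> ?n"
      unfolding order_def by (intro card_mono finite_carrier centralizer_subset)
    with True show ?thesis by simp
  next
    case False
    with card_centralizer_le[OF that] that show ?thesis
      by (auto simp: large_class_elements_def)
  qed
  then have "12 * card commuting_pairs \<le> sum ?w (carrier G)"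
    unfolding card_commuting_pairs[OF finite_carrier] sum_distrib_left by (rule sum_mono)
  moreover have "sum ?w (carrier G) + ?n * card ?E = 12 * ?n + (?n - 1) * (4 * ?n)"
  proof -
    have "sum ?w (carrier G) = 12 * ?n + sum ?w (carrier G - {\<one>})"
      using finite_carrier by (subst sum.remove[of _ \<one>]) simp_all
    also have "sum ?w (carrier G - {\<one>}) = sum ?w (carrier G - {\<one>} - ?E) + sum ?w ?E"
      using E finite_carrier by (intro sum.subset_diff) simp_all
    also have "sum ?w ?E = card ?E * (3 * ?n)"
      using E by (subst sum.cong[OF refl, of ?E ?w "\<lambda>_. 3 * ?n"]) auto
    also have "sum ?w (carrier G - {\<one>} - ?E) = card (carrier G - {\<one>} - ?E) * (4 * ?n)"
      by (subst sum.cong[OF refl, of "carrier G - {\<one>} - ?E" ?w "\<lambda>_. 4 * ?n"]) auto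
    finally have total: "sum ?w (carrier G)
      = 12 * ?n + (card (carrier G - {\<one>} - ?E) * (4 * ?n) + card ?E * (3 * ?n))" .
    have rest: "card ?E + card (carrier G - {\<one>} - ?E) = ?n - 1"
      using card_Diff_subset[OF fin E] card_mono[OF _ E] finite_carrier
      by (simp add: order_def card_Diff_singleton)
    show ?thesis unfolding total rest[symmetric] by (simp add: algebra_simps)
  qed
  moreover have "12 * ?n + (?n - 1) * (4 * ?n) = 4 * ?n\<^sup>2 + 8 * ?n"
    using order_pos by (cases ?n) (auto simp: power2_eq_square algebra_simps)
  ultimately show ?thesis by linarith
qed

text \<open>The assumption on commuting pairs cancels the quadratic terms of the preceding estimate,
  leaving a comparison of two multiples of the order.\<close>

lemma card_large_class_elements: "card large_class_elements \<le> 8"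
proof -
  have "order G * card large_class_elements \<le> order G * 8"
    using twelve_card_commuting_pairs_le order_square_le by linarith
  then show ?thesis using order_pos by (simp only: mult_le_cancel1)
qed

text \<open>With exactly 8 such elements the upper estimate meets the assumed lower bound, so the
  commuting probability is exactly 1/3.\<close>

lemma card_commuting_pairs_eq:
  assumes "card large_class_elements = 8"
  shows "3 * card commuting_pairs = (order G)\<^sup>2"
  using twelve_card_commuting_pairs_le order_square_le assms by simp

lemma card_class_ge:
  assumes "y \<in> carrier G" "y \<noteq> \<one>"
  shows "card (conjugacy_class y) = 3 \<or> y \<in> large_class_elements"
proof -
  have h: "card (conjugacy_class y) * card (centralizer y) = order G"
    by (rule card_conjugacy_class[OF assms(1)])
  then have "card (centralizer y) > 0" using order_pos by (metis mult_is_0 neq0_conv)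
  then have "3 \<le> card (conjugacy_class y)"
    using card_centralizer_le[OF assms] h by (metis mult_le_cancel2)
  moreover have "y \<in> large_class_elements" if "4 \<le> card (conjugacy_class y)"
    using that assms h mult_le_mono1[OF that, of "card (centralizer y)"]
    by (simp add: large_class_elements_def)
  ultimately show ?thesis by linarith
qed

text \<open>Otherwise all nontrivial elements have large classes, so the order is at most 9. A
  nontrivial centralizer contains \<open>\<one>\<close> and \<open>y\<close> and has index at least
  4, hence has order 2, and the group has order 8. Then every square is trivial, so the group is
  abelian, contradicting centralizers of order 2.\<close>

lemma exists_class_of_three:
  assumes "1 < order G"
  obtains x where "x \<in> carrier G" "card (conjugacy_class x) = 3"
proof (rule ccontr)
  assume "\<not> thesis"
  with that have no: "card (conjugacy_class y) \<noteq> 3" if "y \<in> carrier G" for y using that by blast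
  have "carrier G - {\<one>} \<subseteq> large_class_elements" using card_class_ge no by blast
  moreover have "finite large_class_elements"
    using finite_carrier by (auto simp: large_class_elements_def)
  ultimately have "order G \<le> 9"
    using card_mono[of large_class_elements "carrier G - {\<one>}"] card_large_class_elements
    by (simp add: order_def card_Diff_singleton)
  have cent: "centralizer y = {\<one>, y} \<and> order G = 8" if y: "y \<in> carrier G" "y \<noteq> \<one>" for y
  proof -
    have sub: "{\<one>, y} \<subseteq> centralizer y" using y by (auto simp: centralizer_def)
    have fin: "finite (centralizer y)" by (rule finite_subset[OF centralizer_subset finite_carrier])
    have "2 \<le> card (centralizer y)" using card_mono[OF fin sub] y by simp
    moreover have "4 * card (centralizer y) \<le> order G"
      using card_class_ge[OF y] no[OF y(1)] by (simp add: large_class_elements_def)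
    ultimately have h: "card (centralizer y) = 2" using \<open>order G \<le> 9\<close> by linarith
    then have "centralizer y = {\<one>, y}" using card_subset_eq[OF fin sub] y by simp
    moreover have "order G = 8"
    proof -
      have "card (conjugacy_class y) * 2 = order G" using card_conjugacy_class[OF y(1)] h by simp
      then show ?thesis using \<open>order G \<le> 9\<close> \<open>4 * card (centralizer y) \<le> order G\<close> h by presburger
    qed
    ultimately show ?thesis by simp
  qed
  have square: "y \<otimes> y = \<one>" if "y \<in> carrier G" for y
  proof (cases "y = \<one>")
    case False
    have "y \<otimes> y \<in> centralizer y" using that by (simp add: centralizer_def m_assoc)
    with cent[OF that False] False that show ?thesis by auto
  qed simp
  obtain y where y: "y \<in> carrier G" "y \<noteq> \<one>"
  proof -
    have "carrier G \<noteq> {\<one>}" using assms by (auto simp: order_def)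
    then show thesis using that one_closed by blast
  qed
  have "z \<in> centralizer y" if "z \<in> carrier G" for z
  proof -
    have "inv t = t" if "t \<in> carrier G" for t using square[OF that] that inv_equality by blast
    then have "z \<otimes> y = y \<otimes> z" using that y inv_mult_group[of z y] by simp
    then show ?thesis using that by (simp add: centralizer_def)
  qed
  then have "centralizer y = carrier G" using centralizer_subset by blast
  moreover have "card {\<one>, y} = 2" using y by simp
  ultimately show False using cent[OF y] by (simp add: order_def)
qed

end

section \<open>The conjugation action on a class of three elements\<close>

locale class_of_three = small_centralizers G for G (structure) +
  fixes x :: 'a
  assumes x_closed [simp]: "x \<in> carrier G"
    and card_class: "card (conjugacy_class x) = 3"
begin

abbreviation "K \<equiv> class_kernel x"
abbreviation "R \<equiv> class_derangements x"

lemma class_elements: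
  obtains a b c where "conjugacy_class x = {a, b, c}" "a \<noteq> b" "b \<noteq> c" "a \<noteq> c"
    "a \<in> carrier G" "b \<in> carrier G" "c \<in> carrier G"
proof -
  obtain a b c where "conjugacy_class x = {a, b, c}" "a \<noteq> b" "b \<noteq> c" "a \<noteq> c"
    using card_class unfolding card_3_iff by auto
  with that conjugacy_class_subset[OF x_closed] show thesis by auto
qed

text \<open>Conjugation by \<open>g\<close> permutes the class, and these are the six permutations
  of three points. Claims about \<open>K\<close> and \<open>R\<close> thereby become finite checks
  in the symmetric group of degree 3.\<close>

lemma conjugate_cases:
  assumes "conjugacy_class x = {a, b, c}" "a \<noteq> b" "b \<noteq> c" "a \<noteq> c" "g \<in> carrier G"
  obtains "conjugate g a = a" "conjugate g b = b" "conjugate g c = c"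
  | "conjugate g a = a" "conjugate g b = c" "conjugate g c = b"
  | "conjugate g a = b" "conjugate g b = a" "conjugate g c = c"
  | "conjugate g a = b" "conjugate g b = c" "conjugate g c = a"
  | "conjugate g a = c" "conjugate g b = a" "conjugate g c = b"
  | "conjugate g a = c" "conjugate g b = b" "conjugate g c = a"
proof -
  have "a \<in> carrier G" "b \<in> carrier G" "c \<in> carrier G"
    using conjugacy_class_subset[OF x_closed] assms by auto
  then have "conjugate g a \<noteq> conjugate g b" "conjugate g b \<noteq> conjugate g c"
    "conjugate g a \<noteq> conjugate g c"
    using assms by simp_all
  moreover have "conjugate g a \<in> {a, b, c}" "conjugate g b \<in> {a, b, c}" "conjugate g c \<in> {a, b, c}"
    using conjugate_mem_conjugacy_class[OF assms(5) x_closed] assms(1) by auto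
  ultimately show thesis using that assms(2-4) by (smt (verit) insert_iff empty_iff)
qed

lemma mem_K_iff:
  assumes "conjugacy_class x = {a, b, c}"
  shows "g \<in> K \<longleftrightarrow> g \<in> carrier G \<and> conjugate g a = a \<and> conjugate g b = b \<and> conjugate g c = c"
  using assms by (auto simp: class_kernel_def)

lemma mem_R_iff:
  assumes "conjugacy_class x = {a, b, c}"
  shows "g \<in> R \<longleftrightarrow> g \<in> carrier G \<and> conjugate g a \<noteq> a \<and> conjugate g b \<noteq> b \<and> conjugate g c \<noteq> c"
  using assms by (auto simp: class_derangements_def)

text \<open>Elements of \<open>R\<close> act as 3-cycles, and multiplying by an element that acts
  trivially does not change the action.\<close>

lemma R_mult_K:
  assumes "r \<in> R" "k \<in> K"
  shows "r \<otimes> k \<in> R" "k \<otimes> r \<in> R"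
proof -
  obtain a b c where abc: "conjugacy_class x = {a, b, c}" "a \<noteq> b" "b \<noteq> c" "a \<noteq> c"
    "a \<in> carrier G" "b \<in> carrier G" "c \<in> carrier G" by (rule class_elements)
  have car: "r \<in> carrier G" "k \<in> carrier G"
    using assms by (auto simp: class_kernel_def class_derangements_def)
  show "r \<otimes> k \<in> R"
    by (rule conjugate_cases[OF abc(1-4) car(1)];
        use assms abc car in \<open>simp add: conjugate_mult_left mem_K_iff[OF abc(1)] mem_R_iff[OF abc(1)]\<close>)
  show "k \<otimes> r \<in> R"
    by (rule conjugate_cases[OF abc(1-4) car(1)];
        use assms abc car in \<open>simp add: conjugate_mult_left mem_K_iff[OF abc(1)] mem_R_iff[OF abc(1)]\<close>)
qed

lemma R_inv:
  assumes "r \<in> R"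
  shows "inv r \<in> R"
proof -
  note cl = conjugacy_class_subset[OF x_closed, THEN subsetD]
  have "conjugate (inv r) y \<noteq> y" if "y \<in> conjugacy_class x" for y
  proof
    assume "conjugate (inv r) y = y"
    moreover have "r \<in> carrier G" using assms class_derangements_subset by blast
    ultimately have "conjugate r y = y" using cl[OF that] conjugate_inv_cancel(2)[of r y] by metis
    with assms that show False by (auto simp: class_derangements_def)
  qed
  then show ?thesis using assms by (auto simp: class_derangements_def)
qed

lemma R_square:
  assumes "r \<in> R"
  shows "r \<otimes> r \<in> R" "r \<otimes> r \<otimes> r \<in> K"
proof -
  obtain a b c where abc: "conjugacy_class x = {a, b, c}" "a \<noteq> b" "b \<noteq> c" "a \<noteq> c"
    "a \<in> carrier G" "b \<in> carrier G" "c \<in> carrier G" by (rule class_elements)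
  have car: "r \<in> carrier G" using assms by (auto simp: class_derangements_def)
  show "r \<otimes> r \<in> R"
    by (rule conjugate_cases[OF abc(1-4) car];
        use assms abc car in \<open>simp add: conjugate_mult_left mem_K_iff[OF abc(1)] mem_R_iff[OF abc(1)]\<close>)
  show "r \<otimes> r \<otimes> r \<in> K"
    by (rule conjugate_cases[OF abc(1-4) car];
        use assms abc car in \<open>simp add: conjugate_mult_left mem_K_iff[OF abc(1)] mem_R_iff[OF abc(1)]\<close>)
qed

text \<open>There are only two 3-cycles on three points, inverse to each other: \<open>s\<close>
  acts either like \<open>r\<close>, so that \<open>r \<otimes> (r \<otimes> s)\<close> acts like
  the cube of \<open>r\<close>, or like the inverse of \<open>r\<close>.\<close>

lemma R_ratio:
  assumes "r \<in> R" "s \<in> R"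
  shows "r \<otimes> (r \<otimes> s) \<in> K \<or> r \<otimes> s \<in> K"
proof -
  obtain a b c where abc: "conjugacy_class x = {a, b, c}" "a \<noteq> b" "b \<noteq> c" "a \<noteq> c"
    "a \<in> carrier G" "b \<in> carrier G" "c \<in> carrier G" by (rule class_elements)
  have car: "r \<in> carrier G" "s \<in> carrier G"
    using assms by (auto simp: class_derangements_def)
  show ?thesis
    unfolding mem_K_iff[OF abc(1)]
    by (rule conjugate_cases[OF abc(1-4) car(1)]; rule conjugate_cases[OF abc(1-4) car(2)];
        use assms abc car in \<open>simp add: conjugate_mult_left mem_R_iff[OF abc(1)]\<close>)
qed

lemma K_subgroup: "subgroup K G"
  by (simp add: normal_class_kernel normal_imp_subgroup)

lemma K_R_disjoint: "K \<inter> R = {}"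
  using conjugacy_class_self[OF x_closed] by (auto simp: class_kernel_def class_derangements_def)

lemma finite_K: "finite K"
  by (rule finite_subset[OF class_kernel_subset finite_carrier])

lemma finite_R: "finite R"
  by (rule finite_subset[OF class_derangements_subset finite_carrier])

lemma card_centralizer_class:
  assumes "y \<in> conjugacy_class x"
  shows "3 * card (centralizer y) = order G"
proof -
  have "y \<in> carrier G" using assms conjugacy_class_subset[OF x_closed] by blast
  then show ?thesis
    using card_conjugacy_class[of y] conjugacy_class_eq[OF x_closed assms] card_class by simp
qed

lemma K_subset_centralizer:
  assumes "y \<in> conjugacy_class x"
  shows "K \<subseteq> centralizer y"
  by (rule subsetI) (rule commute_class_kernel[OF x_closed _ assms])

lemma card_centralizer_Diff_K:
  assumes "y \<in> conjugacy_class x"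
  shows "card (centralizer y - K) + card K = card (centralizer y)"
proof -
  have "finite (centralizer y)" by (rule finite_subset[OF centralizer_subset finite_carrier])
  then have "card K \<le> card (centralizer y)"
    using K_subset_centralizer[OF assms] by (rule card_mono)
  then show ?thesis
    using card_Diff_subset[OF finite_K K_subset_centralizer[OF assms]] by simp
qed

text \<open>The group is the disjoint union of \<open>K\<close>, \<open>R\<close> and, for each of
  the three points, the elements fixing only that point. Each point stabilizer is a centralizer of
  index 3 containing \<open>K\<close>, so subtracting the three middle parts leaves twice the size
  of \<open>K\<close> for \<open>R\<close>.\<close>

lemma card_R: "card R = 2 * card K"
proof -
  obtain a b c where abc: "conjugacy_class x = {a, b, c}" "a \<noteq> b" "b \<noteq> c" "a \<noteq> c"
    "a \<in> carrier G" "b \<in> carrier G" "c \<in> carrier G" by (rule class_elements)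
  \<comment> \<open>\<open>T y\<close> consists of the elements acting as the transposition that
    fixes \<open>y\<close>.\<close>
  define T where "T y = centralizer y - K" for y
  have fin: "finite (T y)" for y
    unfolding T_def using finite_carrier centralizer_subset finite_subset by blast
  have card_T: "3 * card (T y) + 3 * card K = order G" if "y \<in> {a, b, c}" for y
  proof -
    have y: "y \<in> conjugacy_class x" using that abc by simp
    show ?thesis
      unfolding T_def using card_centralizer_Diff_K[OF y] card_centralizer_class[OF y] by simp
  qed
  have T_iff: "g \<in> T y \<longleftrightarrow> g \<in> carrier G \<and> conjugate g y = y \<and> g \<notin> K" if "y \<in> {a, b, c}" for g y
    using that abc by (auto simp: T_def mem_centralizer_iff)
  note iffs = mem_K_iff[OF abc(1)] mem_R_iff[OF abc(1)] T_iff
  have sub: "K \<subseteq> carrier G" "R \<subseteq> carrier G" "T y \<subseteq> carrier G" for y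
    unfolding T_def using class_kernel_subset class_derangements_subset centralizer_subset by blast+
  have "g \<in> K \<union> (T a \<union> (T b \<union> (T c \<union> R)))" if "g \<in> carrier G" for g
    by (rule conjugate_cases[OF abc(1-4) that]; use that abc(2-4) in \<open>simp add: iffs\<close>)
  then have "carrier G = K \<union> (T a \<union> (T b \<union> (T c \<union> R)))"
    using sub by blast
  moreover have two: "g \<in> K"
    if "g \<in> carrier G" "conjugate g y = y" "conjugate g z = z" "y \<in> {a, b, c}" "z \<in> {a, b, c}" "y \<noteq> z"
    for g y z
    by (rule conjugate_cases[OF abc(1-4) that(1)]; use that abc(2-4) in \<open>auto simp: mem_K_iff[OF abc(1)]\<close>)
  have "T a \<inter> T b = {}" "T a \<inter> T c = {}" "T b \<inter> T c = {}"
    using two[of _ a b] two[of _ a c] two[of _ b c] abc(2-4) by (auto simp: T_iff)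
  moreover have "T a \<inter> R = {}" "T b \<inter> R = {}" "T c \<inter> R = {}"
    by (auto simp: T_iff mem_R_iff[OF abc(1)])
  moreover have "K \<inter> T a = {}" "K \<inter> T b = {}" "K \<inter> T c = {}" "K \<inter> R = {}"
    using K_R_disjoint by (auto simp: T_def)
  ultimately have "card (carrier G) = card K + (card (T a) + (card (T b) + (card (T c) + card R)))"
    using fin finite_K finite_R by (simp add: card_Un_disjoint Int_Un_distrib)
  with card_T[of a] card_T[of b] card_T[of c] show ?thesis by (simp add: order_def)
qed

text \<open>The quotient by \<open>K\<close> embeds into the symmetric group of degree 3.
  Concretely, two elements acting as the transposition of \<open>b\<close> and \<open>c\<close> have
  their product in \<open>K\<close>, so the centralizer of \<open>a\<close>, which has index 3, has
  at most twice as many elements as \<open>K\<close>.\<close>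

lemma order_le: "order G \<le> 6 * card K"
proof -
  obtain a b c where abc: "conjugacy_class x = {a, b, c}" "a \<noteq> b" "b \<noteq> c" "a \<noteq> c"
    "a \<in> carrier G" "b \<in> carrier G" "c \<in> carrier G" by (rule class_elements)
  have a: "a \<in> conjugacy_class x" using abc by simp
  have "card (centralizer a - K) \<le> card K"
  proof (cases "centralizer a \<subseteq> K")
    case True
    then have "centralizer a - K = {}" by blast
    then show ?thesis by (simp only: card.empty zero_le)
  next
    case False
    then obtain t where t: "t \<in> centralizer a" "t \<notin> K" by auto
    show ?thesis
    proof (rule card_inj_on_le)
      show "finite K" by (rule finite_K)
      show "inj_on (\<lambda>g. g \<otimes> t) (centralizer a - K)"
        using t by (auto simp: inj_on_def centralizer_def)
      have swap: "conjugate g b = c \<and> conjugate g c = b \<and> conjugate g a = a \<and> g \<in> carrier G"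
        if "g \<in> centralizer a" "g \<notin> K" for g
      proof -
        have g: "g \<in> carrier G" using that by (simp add: centralizer_def)
        show ?thesis
          by (rule conjugate_cases[OF abc(1-4) g];
              use that abc g in \<open>simp add: mem_K_iff[OF abc(1)] mem_centralizer_iff\<close>)
      qed
      show "(\<lambda>g. g \<otimes> t) ` (centralizer a - K) \<subseteq> K"
      proof (rule image_subsetI)
        fix g assume "g \<in> centralizer a - K"
        then show "g \<otimes> t \<in> K"
          unfolding mem_K_iff[OF abc(1)]
          using swap[of g] swap[OF t] abc(5-7) by (simp add: conjugate_mult_left)
      qed
    qed
  qed
  then show ?thesis
    using card_centralizer_Diff_K[OF a] card_centralizer_class[OF a] by simp
qed

text \<open>The centralizer of \<open>u\<close> contains the subgroup generated by \<open>K\<close> and \<open>r\<close>, whose index is at most 2.\<close>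

lemma centralizing_K_and_derangement:
  assumes u: "u \<in> carrier G" and K: "K \<subseteq> centralizer u" and r: "r \<in> R" "r \<in> centralizer u"
  shows "u = \<one>"
proof (rule ccontr)
  assume "u \<noteq> \<one>"
  interpret C: subgroup "centralizer u" G by (rule subgroup_centralizer[OF u])
  have rc: "r \<in> carrier G" using r(2) by (rule C.mem_carrier)
  have cancel: "t \<in> centralizer u" if "r \<otimes> t \<in> centralizer u" "t \<in> carrier G" for t
  proof -
    have "inv r \<otimes> (r \<otimes> t) \<in> centralizer u" using r(2) that(1) by blast
    then show ?thesis using rc that(2) by (simp flip: m_assoc)
  qed
  have "s \<in> centralizer u" if s: "s \<in> R" for s
  proof -
    have "s \<in> carrier G" using s class_derangements_subset by blast
    then show ?thesis using R_ratio[OF r(1) s] K cancel rc by blast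
  qed
  then have "card (K \<union> R) \<le> card (centralizer u)"
    using K by (intro card_mono finite_subset[OF centralizer_subset finite_carrier]) blast
  then have "3 * card K \<le> card (centralizer u)"
    using K_R_disjoint finite_K finite_R card_R by (simp add: card_Un_disjoint)
  moreover have "card K > 0" using finite_K K_subgroup subgroup.one_closed card_gt_0_iff by blast
  ultimately show False using card_centralizer_le[OF u \<open>u \<noteq> \<one>\<close>] order_le by simp
qed

text \<open>If one conjugate lies in the normal subgroup \<open>K\<close>, all do. If
  \<open>a\<close> and \<open>b\<close> lie outside \<open>K\<close>, they act as distinct
  transpositions, so \<open>a \<otimes> b\<close> is in \<open>R\<close>. It commutes with itself
  and with \<open>K\<close>, which fixes \<open>a\<close> and \<open>b\<close>; hence it is trivial,
  although \<open>\<one>\<close> is not in \<open>R\<close>.\<close>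

lemma class_subset_K: "conjugacy_class x \<subseteq> K"
proof -
  obtain a b c where abc: "conjugacy_class x = {a, b, c}" "a \<noteq> b" "b \<noteq> c" "a \<noteq> c"
    "a \<in> carrier G" "b \<in> carrier G" "c \<in> carrier G" by (rule class_elements)
  have all: "conjugacy_class x \<subseteq> K" if y: "y \<in> conjugacy_class x" "y \<in> K" for y
  proof
    fix z assume "z \<in> conjugacy_class x"
    then obtain g where "g \<in> carrier G" "z = conjugate g y"
      using conjugacy_class_eq[OF x_closed y(1)] by (auto simp: conjugacy_class_def)
    then show "z \<in> K"
      using normal_invE(2)[OF normal_class_kernel[OF x_closed]] y(2) by (simp add: conjugate_def)
  qed
  show ?thesis
  proof (cases "a \<in> K \<or> b \<in> K")
    case True
    then show ?thesis using all[of a] all[of b] abc by auto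
  next
    case False
    have "conjugate a a = a" "conjugate b b = b" using abc by (simp_all add: conjugate_eq_self_iff)
    have a: "conjugate a a = a \<and> conjugate a b = c \<and> conjugate a c = b"
      by (rule conjugate_cases[OF abc(1-4,5)];
          use False \<open>conjugate a a = a\<close> abc in \<open>simp add: mem_K_iff[OF abc(1)]\<close>)
    have b: "conjugate b a = c \<and> conjugate b b = b \<and> conjugate b c = a"
      by (rule conjugate_cases[OF abc(1-4,6)];
          use False \<open>conjugate b b = b\<close> abc in \<open>simp add: mem_K_iff[OF abc(1)]\<close>)
    have ab: "a \<otimes> b \<in> R"
      unfolding mem_R_iff[OF abc(1)] using a b abc by (simp add: conjugate_mult_left)
    have "K \<subseteq> centralizer (a \<otimes> b)"
      using abc by (auto simp: mem_K_iff[OF abc(1)] mem_centralizer_iff conjugate_mult_right)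
    moreover have "a \<otimes> b \<in> centralizer (a \<otimes> b)" using abc by (simp add: centralizer_def)
    ultimately have "a \<otimes> b = \<one>"
      using centralizing_K_and_derangement[OF _ _ ab] abc by simp
    then have "\<one> \<in> K \<inter> R" using ab K_subgroup subgroup.one_closed by auto
    then show ?thesis using K_R_disjoint by simp
  qed
qed

lemma one_notin_class: "\<one> \<notin> conjugacy_class x"
proof
  assume "\<one> \<in> conjugacy_class x"
  then have "conjugacy_class x = conjugacy_class \<one>"
    using conjugacy_class_eq[OF x_closed] by simp
  moreover have "conjugacy_class \<one> = {\<one>}" by (force simp: conjugacy_class_def)
  ultimately show False using card_class by simp
qed

text \<open>Multiplication embeds the product of the four-element set \<open>?V\<close> and the
  centralizer of \<open>r\<close> into the group.\<close>

lemma four_card_centralizer_le: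
  assumes r: "r \<in> R"
  shows "4 * card (centralizer r) \<le> order G"
proof -
  \<comment> \<open>All members of \<open>?V\<close> commute with \<open>K\<close>. It serves only
    as a set here; that it equals the subgroup \<open>K\<close> follows later.\<close>
  let ?V = "insert \<one> (conjugacy_class x)"
  have rc: "r \<in> carrier G" using r class_derangements_subset by blast
  have VK: "?V \<subseteq> K" using class_subset_K K_subgroup subgroup.one_closed by blast
  have V: "u \<in> carrier G" "K \<subseteq> centralizer u" if "u \<in> ?V" for u
  proof -
    show "u \<in> carrier G" using that VK class_kernel_subset[of x] by blast
    show "K \<subseteq> centralizer u"
    proof (cases "u = \<one>")
      case True
      then show ?thesis
        using class_kernel_subset[of x] by (simp add: centralizer_def subset_iff)
    next
      case False
      then show ?thesis using that K_subset_centralizer[of u] by simp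
    qed
  qed
  have "finite (conjugacy_class x)" using card_class by (simp add: card_ge_0_finite)
  then have card_V: "card ?V = 4" using card_class one_notin_class by simp
  \<comment> \<open>The quotient of \<open>u\<close> by \<open>u'\<close> equals that of
    \<open>h'\<close> by \<open>h\<close>, so it commutes with \<open>r\<close>; being built from
    members of \<open>?V\<close>, it also commutes with \<open>K\<close>. By
    \<open>centralizing_K_and_derangement\<close> it is trivial.\<close>
  have uniq: "u = u'"
    if u: "u \<in> ?V" "u' \<in> ?V" and h: "h \<in> centralizer r" "h' \<in> centralizer r"
      and eq: "u \<otimes> h = u' \<otimes> h'" for u u' h h'
  proof -
    have car: "u \<in> carrier G" "u' \<in> carrier G" "h \<in> carrier G" "h' \<in> carrier G"
      using V(1)[OF u(1)] V(1)[OF u(2)] h centralizer_subset[of r] by blast+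
    have "inv u' \<otimes> u = inv u' \<otimes> (u \<otimes> h) \<otimes> inv h" using car by (simp add: m_assoc)
    also have "\<dots> = h' \<otimes> inv h" unfolding eq using car by (simp flip: m_assoc)
    finally have "inv u' \<otimes> u \<in> centralizer r"
      using subgroup_centralizer[OF rc] h by (simp add: subgroup.m_closed subgroup.m_inv_closed)
    then have r': "r \<in> centralizer (inv u' \<otimes> u)" by (rule centralizer_sym[OF rc])
    have "K \<subseteq> centralizer (inv u' \<otimes> u)"
    proof
      fix k assume k: "k \<in> K"
      then have kc: "k \<in> carrier G" using class_kernel_subset by blast
      interpret Ck: subgroup "centralizer k" G by (rule subgroup_centralizer[OF kc])
      have "u \<in> centralizer k" "u' \<in> centralizer k"
        using centralizer_sym[OF car(1)] centralizer_sym[OF car(2)] V(2)[OF u(1)] V(2)[OF u(2)] k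
        by auto
      then have "inv u' \<otimes> u \<in> centralizer k" by simp
      then show "k \<in> centralizer (inv u' \<otimes> u)" by (rule centralizer_sym[OF kc])
    qed
    then have "inv u' \<otimes> u = \<one>" using centralizing_K_and_derangement[OF _ _ r r'] car by simp
    then have "u' \<otimes> (inv u' \<otimes> u) = u'" using car by simp
    then show "u = u'" using car by (simp flip: m_assoc)
  qed
  have inj: "inj_on (\<lambda>p. fst p \<otimes> snd p) (?V \<times> centralizer r)"
  proof (rule inj_onI)
    fix p q assume p: "p \<in> ?V \<times> centralizer r" and q: "q \<in> ?V \<times> centralizer r"
      and eq: "fst p \<otimes> snd p = fst q \<otimes> snd q"
    have "fst p = fst q"
      using uniq[OF _ _ _ _ eq] p q by (simp only: mem_Times_iff)
    moreover have "snd p = snd q"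
    proof -
      have "fst q \<in> carrier G" "snd p \<in> carrier G" "snd q \<in> carrier G"
        using p q V(1)[of "fst q"] centralizer_subset[of r, THEN subsetD] by (simp_all only: mem_Times_iff)
      then show ?thesis using eq \<open>fst p = fst q\<close> by simp
    qed
    ultimately show "p = q" by (rule prod_eqI)
  qed
  have "card (?V \<times> centralizer r) \<le> order G"
    unfolding order_def
  proof (rule card_inj_on_le[OF inj _ finite_carrier], rule image_subsetI)
    fix p assume "p \<in> ?V \<times> centralizer r"
    then show "fst p \<otimes> snd p \<in> carrier G"
      using V(1)[of "fst p"] centralizer_subset[of r, THEN subsetD, of "snd p"] by (simp only: mem_Times_iff m_closed)
  qed
  then show ?thesis by (simp add: card_V card_cartesian_product)
qed

text \<open>\<open>K\<close> contains the identity and the three conjugates, so \<open>R\<close> has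
  at least 8 elements; \<open>R\<close> also lies in \<open>large_class_elements\<close>, which has
  at most 8. All these inequalities are therefore equalities.\<close>

lemma card_K: "card K = 4"
  and R_eq: "R = large_class_elements"
  and card_large: "card large_class_elements = 8"
proof -
  have "\<one> \<notin> R" using K_R_disjoint K_subgroup subgroup.one_closed by blast
  then have sub: "R \<subseteq> large_class_elements"
    using four_card_centralizer_le class_derangements_subset
    by (auto simp: large_class_elements_def)
  have fin: "finite large_class_elements"
    using finite_carrier by (auto simp: large_class_elements_def)
  have "insert \<one> (conjugacy_class x) \<subseteq> K"
    using class_subset_K K_subgroup subgroup.one_closed by blast
  moreover have "card (insert \<one> (conjugacy_class x)) = 4"
    using card_class one_notin_class by (simp add: card_ge_0_finite)
  ultimately have "4 \<le> card K" using card_mono[OF finite_K] by metis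
  moreover have "card R \<le> card large_class_elements" by (rule card_mono[OF fin sub])
  ultimately show "card K = 4" "card large_class_elements = 8"
    using card_large_class_elements card_R by linarith+
  then show "R = large_class_elements"
    using card_subset_eq[OF fin sub] card_R by simp
qed

lemma K_eq: "K = insert \<one> (conjugacy_class x)"
proof -
  have "insert \<one> (conjugacy_class x) \<subseteq> K"
    using class_subset_K K_subgroup subgroup.one_closed by blast
  moreover have "card (insert \<one> (conjugacy_class x)) = 4"
    using card_class one_notin_class by (simp add: card_ge_0_finite)
  ultimately show ?thesis using card_subset_eq[OF finite_K] card_K by metis
qed

text \<open>By \<open>K_eq\<close>, a nontrivial element of \<open>K\<close> is a conjugate of
  \<open>x\<close>, and these are centralized by all of \<open>K\<close>.\<close>

lemma K_commutes:
  assumes "k \<in> K" "l \<in> K"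
  shows "k \<otimes> l = l \<otimes> k"
proof (cases "l = \<one>")
  case True
  then show ?thesis using assms(1) class_kernel_subset[of x] by auto
next
  case False
  then have "l \<in> conjugacy_class x" using assms(2) K_eq by blast
  then show ?thesis using K_subset_centralizer assms(1) by (auto simp: centralizer_def)
qed

lemma exists_R: obtains r where "r \<in> R"
  using card_large R_eq by (metis all_not_in_conv card.empty zero_neq_numeral)

text \<open>An element \<open>g\<close> outside \<open>K \<union> R\<close> would act on the class of \<open>x\<close> as a transposition and would
  itself have a class of size 3. Both classes give the same set of derangements, but \<open>r g\<close> with
  \<open>r\<close> a derangement is one only for the class of \<open>g\<close>.\<close>

lemma carrier_eq: "carrier G = K \<union> R"
proof (rule ccontr)
  assume "carrier G \<noteq> K \<union> R"
  then obtain g where g: "g \<in> carrier G" "g \<notin> K" "g \<notin> R"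
    using class_kernel_subset class_derangements_subset by blast
  have "g \<noteq> \<one>" using g K_subgroup subgroup.one_closed by blast
  then have "card (conjugacy_class g) = 3" using card_class_ge[OF g(1)] g(3) R_eq by blast
  then interpret g: class_of_three G g using g(1) by unfold_locales
  obtain r where r: "r \<in> R" by (rule exists_R)
  then have rc: "r \<in> carrier G" using class_derangements_subset by blast
  have "g \<in> g.K" using g.class_subset_K conjugacy_class_self[OF g(1)] by blast
  then have "r \<otimes> g \<in> R" using g.R_mult_K(1) r R_eq g.R_eq by blast
  obtain a b c where abc: "conjugacy_class x = {a, b, c}" "a \<noteq> b" "b \<noteq> c" "a \<noteq> c"
    "a \<in> carrier G" "b \<in> carrier G" "c \<in> carrier G" by (rule class_elements)
  show False
    by (rule conjugate_cases[OF abc(1-4) g(1)]; rule conjugate_cases[OF abc(1-4) rc];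
        use r g abc rc \<open>r \<otimes> g \<in> R\<close> in
          \<open>simp add: conjugate_mult_left mem_K_iff[OF abc(1)] mem_R_iff[OF abc(1)]\<close>)
qed

lemma order_eq: "order G = 12"
  using carrier_eq K_R_disjoint finite_K finite_R card_R card_K
  by (simp add: order_def card_Un_disjoint)

text \<open>In order 12 the centralizer of \<open>r\<close> has at most 3 elements, and
  \<open>\<one>\<close>, \<open>r\<close> and \<open>r \<otimes> r\<close> are already distinct. The
  cube of \<open>r\<close> lies in this centralizer and in \<open>K\<close>, while \<open>r\<close>
  and its square lie in \<open>R\<close>, so the cube is trivial.\<close>

lemma centralizer_derangement:
  assumes r: "r \<in> R"
  shows "centralizer r = {\<one>, r, r \<otimes> r}"
    and "card (centralizer r) = 3"
    and "r \<otimes> r \<otimes> r = \<one>"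
proof -
  have rc: "r \<in> carrier G" using r class_derangements_subset by blast
  have "\<one> \<notin> R" using K_R_disjoint K_subgroup subgroup.one_closed by blast
  then have ne: "r \<noteq> \<one>" "r \<otimes> r \<noteq> \<one>" using r R_square(1)[OF r] by auto
  then have "r \<otimes> r \<noteq> r" using rc by simp
  with ne have c3: "card {\<one>, r, r \<otimes> r} = 3" by auto
  have sub: "{\<one>, r, r \<otimes> r} \<subseteq> centralizer r" using rc by (auto simp: centralizer_def m_assoc)
  have fin: "finite (centralizer r)" by (rule finite_subset[OF centralizer_subset finite_carrier])
  have "card (centralizer r) \<le> 3" using four_card_centralizer_le[OF r] order_eq by simp
  then show c: "card (centralizer r) = 3" using card_mono[OF fin sub] c3 by simp
  then show eq: "centralizer r = {\<one>, r, r \<otimes> r}" using card_subset_eq[OF fin sub] c3 by simp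
  have "r \<otimes> r \<otimes> r \<in> centralizer r" using rc by (simp add: centralizer_def m_assoc)
  then show "r \<otimes> r \<otimes> r = \<one>" using eq R_square[OF r] r K_R_disjoint by auto
qed

text \<open>For \<open>g\<close> in \<open>R\<close>, \<open>R_ratio\<close> puts
  \<open>r \<otimes> g\<close> or \<open>r \<otimes> (r \<otimes> g)\<close> into \<open>K\<close>;
  conjugation moves the powers of \<open>r\<close> to the right, and since \<open>r\<close> has
  order 3 they can be undone by a further power.\<close>

lemma K_and_derangement_generate:
  assumes r: "r \<in> R" and g: "g \<in> carrier G"
  shows "\<exists>k\<in>K. \<exists>i::nat. g = k \<otimes> r [^] i"
proof (cases "g \<in> K")
  case True
  then show ?thesis using g by (intro bexI[of _ g] exI[of _ 0]) auto
next
  case False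
  then have gR: "g \<in> R" using carrier_eq g by blast
  have rc: "r \<in> carrier G" using r class_derangements_subset by blast
  note r3 = centralizer_derangement(3)[OF r]
  interpret K: normal K G by (rule normal_class_kernel[OF x_closed])
  have "g \<otimes> r \<in> K \<or> g \<otimes> (r \<otimes> r) \<in> K"
  proof -
    have "r \<otimes> g \<in> K \<or> r \<otimes> (r \<otimes> g) \<in> K" using R_ratio[OF r gR] by blast
    moreover have "g \<otimes> r \<in> K" if "r \<otimes> g \<in> K"
    proof -
      have "inv r \<otimes> (r \<otimes> g) \<otimes> r \<in> K" using K.inv_op_closed1 that rc by blast
      then show ?thesis using rc g by (simp flip: m_assoc)
    qed
    moreover have "g \<otimes> (r \<otimes> r) \<in> K" if "r \<otimes> (r \<otimes> g) \<in> K"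
    proof -
      have "inv (r \<otimes> r) \<otimes> (r \<otimes> r \<otimes> g) \<otimes> (r \<otimes> r) \<in> K"
        using K.inv_op_closed1[of "r \<otimes> r" "r \<otimes> r \<otimes> g"] that rc g by (simp add: m_assoc)
      moreover have "inv (r \<otimes> r) \<otimes> (r \<otimes> r \<otimes> g) = g"
        using rc g m_assoc[of "inv (r \<otimes> r)" "r \<otimes> r" g] by simp
      ultimately show ?thesis by simp
    qed
    ultimately show ?thesis by blast
  qed
  then show ?thesis
  proof
    assume "g \<otimes> r \<in> K"
    moreover have "g = g \<otimes> r \<otimes> r [^] (2::nat)"
      using r3 rc g by (simp add: numeral_2_eq_2 m_assoc)
    ultimately show ?thesis by blast
  next
    assume "g \<otimes> (r \<otimes> r) \<in> K"
    moreover have "g = g \<otimes> (r \<otimes> r) \<otimes> r [^] (1::nat)"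
      using r3 rc g by (simp add: m_assoc)
    ultimately show ?thesis by blast
  qed
qed

text \<open>The isomorphism is the conjugation action on the class of a derangement, which has 4 elements.
  The derangements have order 3 and generate the group, so they act by even permutations.\<close>

lemma iso_alt_group_4: "\<exists>\<pi>. \<pi> \<in> iso G (alt_group 4)"
proof -
  obtain r where r: "r \<in> R" by (rule exists_R)
  then have rc: "r \<in> carrier G" using class_derangements_subset by blast
  define A where "A = conjugacy_class r"
  have A_carrier: "y \<in> carrier G" if "y \<in> A" for y
    using that conjugacy_class_subset[OF rc] by (auto simp: A_def)
  have A_conj: "conjugate g y \<in> A" if "g \<in> carrier G" "y \<in> A" for g y
    using that conjugate_mem_conjugacy_class[OF _ rc] by (simp add: A_def)
  have card_A: "card A = 4"
    using card_conjugacy_class[OF rc] centralizer_derangement(2)[OF r] order_eq by (simp add: A_def)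
  then have fin_A: "finite A" by (simp add: card_ge_0_finite)
  define I where "I = {1..4::nat}"
  obtain f where f: "bij_betw f A I"
    using finite_same_card_bij[OF fin_A, of I] card_A by (auto simp: I_def)
  \<comment> \<open>The action on the class is transported along \<open>f\<close> to the points 1 to
    4; all other numbers are fixed, as \<open>permutes\<close> demands.\<close>
  define \<pi> where "\<pi> g i = (if i \<in> I then f (conjugate g (inv_into A f i)) else i)" for g i
  have f_inv: "inv_into A f i \<in> A" "f (inv_into A f i) = i" if "i \<in> I" for i
    using that f bij_betw_inv_into bij_betwE bij_betw_inv_into_right by metis+
  have inv_f: "f y \<in> I" "inv_into A f (f y) = y" if "y \<in> A" for y
    using that f bij_betwE bij_betw_inv_into_left by metis+
  have hom: "\<pi> (g \<otimes> h) = \<pi> g \<circ> \<pi> h" if "g \<in> carrier G" "h \<in> carrier G" for g h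
  proof
    fix i show "\<pi> (g \<otimes> h) i = (\<pi> g \<circ> \<pi> h) i"
    proof (cases "i \<in> I")
      case True
      then have "conjugate h (inv_into A f i) \<in> A" using A_conj f_inv(1) that by blast
      then show ?thesis
        using True inv_f f_inv(1)[OF True] A_carrier that
        by (simp add: \<pi>_def conjugate_mult_left)
    qed (simp add: \<pi>_def)
  qed
  have one: "\<pi> \<one> = id"
  proof
    fix i show "\<pi> \<one> i = id i"
      using f_inv[of i] A_carrier by (simp add: \<pi>_def)
  qed
  have permutes: "\<pi> g permutes I" if g: "g \<in> carrier G" for g
  proof (rule bij_imp_permutes)
    have "\<pi> g \<circ> \<pi> (inv g) = id" "\<pi> (inv g) \<circ> \<pi> g = id"
      using hom[of g "inv g"] hom[of "inv g" g] one g by simp_all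
    moreover have "\<pi> h i \<in> I" if "i \<in> I" "h \<in> carrier G" for h i
      using that inv_f(1) A_conj f_inv(1) by (simp add: \<pi>_def)
    ultimately show "bij_betw (\<pi> g) I I"
      using g by (intro bij_betw_byWitness[where f' = "\<pi> (inv g)"])
        (auto simp: fun_eq_iff)
  qed (simp add: \<pi>_def)
  then have permutation: "permutation (\<pi> g)" if "g \<in> carrier G" for g
    using that unfolding permutation_permutes I_def by blast
  have even_R: "evenperm (\<pi> s)" if s: "s \<in> R" for s
  proof -
    have sc: "s \<in> carrier G" using s class_derangements_subset by blast
    have "\<pi> s \<circ> \<pi> s \<circ> \<pi> s = id"
      using hom[of "s \<otimes> s" s] hom[of s s] one centralizer_derangement(3)[OF s] sc by simp
    moreover have "evenperm (\<pi> s \<circ> \<pi> s \<circ> \<pi> s) \<longleftrightarrow> evenperm (\<pi> s)"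
      using permutation[OF sc] by (simp add: evenperm_comp permutation_compose)
    ultimately show ?thesis by simp
  qed
  have even: "evenperm (\<pi> g)" if g: "g \<in> carrier G" for g
  proof (cases "g \<in> R")
    case False
    then have "g \<in> K" using g carrier_eq by blast
    \<comment> \<open>An element of \<open>K\<close> is a product of two derangements,
      \<open>g \<otimes> r\<close> and \<open>inv r\<close>.\<close>
    then have gr: "g \<otimes> r \<in> R" "inv r \<in> R" using R_mult_K(2)[OF r] R_inv[OF r] by auto
    have "\<pi> g = \<pi> (g \<otimes> r) \<circ> \<pi> (inv r)"
      using hom[of "g \<otimes> r" "inv r"] g rc by (simp add: m_assoc)
    moreover have "permutation (\<pi> (g \<otimes> r))" "permutation (\<pi> (inv r))"
      using permutation g rc by simp_all
    ultimately show ?thesis using even_R[OF gr(1)] even_R[OF gr(2)] by (simp add: evenperm_comp)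
  qed (rule even_R)
  \<comment> \<open>An element acting trivially commutes with the four members of \<open>A\<close>,
    so it is not in \<open>R\<close>, where centralizers have order 3. Hence it lies in the abelian
    group \<open>K\<close>; as it also commutes with \<open>r\<close>, it is trivial.\<close>
  have trivial: "g = \<one>" if g: "g \<in> carrier G" and "\<pi> g = id" for g
  proof -
    have "conjugate g y = y" if y: "y \<in> A" for y
    proof -
      have "f (conjugate g y) = f y"
        using fun_cong[OF \<open>\<pi> g = id\<close>, of "f y"] inv_f[OF y]
        by (simp add: \<pi>_def)
      then show ?thesis using inv_f(2) A_conj[OF g y] y by metis
    qed
    then have cent: "A \<subseteq> centralizer g"
      using A_carrier g by (auto simp: centralizer_def conjugate_eq_self_iff)
    have fin: "finite (centralizer g)" by (rule finite_subset[OF centralizer_subset finite_carrier])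
    have "g \<notin> R" using centralizer_derangement(2)[of g] card_mono[OF fin cent] card_A by auto
    then have "g \<in> K" using carrier_eq g by blast
    then have "K \<subseteq> centralizer g"
      using K_commutes class_kernel_subset[of x] by (auto simp: centralizer_def)
    moreover have "r \<in> centralizer g" using cent conjugacy_class_self[OF rc] by (auto simp: A_def)
    ultimately show ?thesis using centralizing_K_and_derangement[OF g _ r] by blast
  qed
  have hom': "\<pi> \<in> hom G (alt_group 4)"
    using permutes even hom by (auto simp: hom_def alt_group_carrier alt_group_mult I_def)
  then interpret \<pi>: group_hom G "alt_group 4" \<pi>
    by (intro group_hom.intro group_hom_axioms.intro is_group alt_group_is_group)
  have inj: "inj_on \<pi> (carrier G)"
    using trivial by (simp add: \<pi>.inj_on_one_iff alt_group_one)
  have "2 * card (carrier (alt_group 4)) = 24"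
    using alt_group_card_carrier[of 4] by (simp add: fact_numeral)
  then have card12: "card (carrier (alt_group 4)) = 12" by simp
  then have "\<pi> ` carrier G = carrier (alt_group 4)"
    using card_image[OF inj] order_eq \<pi>.homh
    by (intro card_subset_eq) (auto simp: order_def intro!: card_ge_0_finite)
  then have "\<pi> \<in> iso G (alt_group 4)" using inj hom' by (simp add: iso_def bij_betw_def)
  then show ?thesis by blast
qed

end

text \<open>The last claim is the form in which the structure is later lifted from the quotient to
  the whole group, to control its derived subgroup. Here \<open>W\<close> is \<open>K\<close> and
  \<open>t\<close> is a derangement.\<close>

lemma (in small_centralizers) alternating_structure:
  assumes "1 < order G"
  shows "3 * card commuting_pairs = (order G)\<^sup>2"
    and "\<exists>\<pi>. \<pi> \<in> iso G (alt_group 4)"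
    and "\<exists>W t. W \<lhd> G \<and> t \<in> carrier G \<and> (\<forall>v\<in>W. \<forall>w\<in>W. v \<otimes> w = w \<otimes> v) \<and>
      (\<forall>g\<in>carrier G. \<exists>w\<in>W. \<exists>i::nat. g = w \<otimes> t [^] i)"
proof -
  obtain x where x: "x \<in> carrier G" "card (conjugacy_class x) = 3"
    by (rule exists_class_of_three[OF assms])
  interpret class_of_three G x using x by unfold_locales
  show "3 * card commuting_pairs = (order G)\<^sup>2" by (rule card_commuting_pairs_eq[OF card_large])
  show "\<exists>\<pi>. \<pi> \<in> iso G (alt_group 4)" by (rule iso_alt_group_4)
  obtain r where r: "r \<in> R" by (rule exists_R)
  then have "r \<in> carrier G" using class_derangements_subset by blast
  then show "\<exists>W t. W \<lhd> G \<and> t \<in> carrier G \<and> (\<forall>v\<in>W. \<forall>w\<in>W. v \<otimes> w = w \<otimes> v) \<and>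
      (\<forall>g\<in>carrier G. \<exists>w\<in>W. \<exists>i::nat. g = w \<otimes> t [^] i)"
    using normal_class_kernel[OF x(1)] K_commutes K_and_derangement_generate[OF r] by blast
qed

section \<open>Isoclinism\<close>

context group
begin

section \<open>Groups generated by an abelian subgroup and one further element\<close>

lemma subgroup_nat_pow_closed:
  assumes "subgroup H G" "h \<in> H"
  shows "h [^] (n::nat) \<in> H"
  using assms by (induction n) (auto simp: subgroup.one_closed subgroup.m_closed)

text \<open>A subgroup containing \<open>W\<close> and \<open>t\<close> is the whole group. This is
  applied to the centralizers of the elements of \<open>W\<close>, then of \<open>t\<close>, and
  finally of an arbitrary element.\<close>

lemma comm_group_of_abelian_and_element:
  assumes gen: "\<And>g. g \<in> carrier G \<Longrightarrow> \<exists>w\<in>W. \<exists>i::nat. g = w \<otimes> t [^] i"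
    and W: "W \<subseteq> carrier G" "\<And>v w. v \<in> W \<Longrightarrow> w \<in> W \<Longrightarrow> v \<otimes> w = w \<otimes> v"
    and t: "t \<in> carrier G" "\<And>w. w \<in> W \<Longrightarrow> w \<otimes> t = t \<otimes> w"
  shows "comm_group G"
proof -
  have sub: "g \<in> C" if "subgroup C G" "W \<subseteq> C" "t \<in> C" "g \<in> carrier G" for g C
  proof -
    obtain w and i :: nat where "w \<in> W" "g = w \<otimes> t [^] i" using gen \<open>g \<in> carrier G\<close> by blast
    then show ?thesis
      using that by (simp add: subgroup_nat_pow_closed subgroup.m_closed subset_iff)
  qed
  have W_cent: "g \<in> centralizer w" if "w \<in> W" "g \<in> carrier G" for g w
  proof -
    have w: "w \<in> carrier G" using that W by blast
    show ?thesis
    proof (rule sub)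
      show "subgroup (centralizer w) G" by (rule subgroup_centralizer[OF w])
      show "W \<subseteq> centralizer w" "t \<in> centralizer w"
        using that W t by (auto simp: centralizer_def)
    qed (rule that)
  qed
  have t_cent: "g \<in> centralizer t" if "g \<in> carrier G" for g
  proof (rule sub)
    show "subgroup (centralizer t) G" by (rule subgroup_centralizer[OF t(1)])
    show "W \<subseteq> centralizer t" "t \<in> centralizer t"
      using W t by (auto simp: centralizer_def)
  qed (rule that)
  have "h \<in> centralizer g" if "g \<in> carrier G" "h \<in> carrier G" for g h
  proof (rule sub)
    show "subgroup (centralizer g) G" by (rule subgroup_centralizer[OF that(1)])
    show "W \<subseteq> centralizer g" using W_cent[OF _ that(1)] W centralizer_sym by blast
    show "t \<in> centralizer g" using t_cent[OF that(1)] t centralizer_sym by blast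
  qed (rule that)
  then show ?thesis by (intro group_comm_groupI) (simp add: centralizer_def)
qed

text \<open>Because \<open>W\<close> is abelian and normal, \<open>w \<mapsto> [w, t]\<close> is a
  homomorphism on \<open>W\<close>. Its image \<open>D\<close> is normal in \<open>G\<close>, and
  modulo \<open>D\<close> the element \<open>t\<close> commutes with \<open>W\<close>, so the
  quotient is abelian. Thus every element of the derived subgroup is a single commutator.\<close>

lemma derived_subset_commutators:
  assumes W: "W \<lhd> G" and comm: "\<And>v w. v \<in> W \<Longrightarrow> w \<in> W \<Longrightarrow> v \<otimes> w = w \<otimes> v"
    and t: "t \<in> carrier G"
    and gen: "\<And>g. g \<in> carrier G \<Longrightarrow> \<exists>w\<in>W. \<exists>i::nat. g = w \<otimes> t [^] i"
  shows "derived G (carrier G) \<subseteq> (\<lambda>w. commutator G w t) ` W"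
proof -
  interpret W: normal W G by (rule W)
  \<comment> \<open>This writes \<open>[w, t]\<close> as a product of two elements of
    \<open>W\<close>, so that commutativity of \<open>W\<close> applies to the factors.\<close>
  define c where "c w = w \<otimes> conjugate t (inv w)" for w
  define D where "D = c ` W"
  have c_eq: "commutator G w t = c w" if "w \<in> W" for w
    using that t by (simp add: commutator_def c_def conjugate_def m_assoc)
  have conj_W: "conjugate g w \<in> W" if "g \<in> carrier G" "w \<in> W" for g w
    using W.inv_op_closed2 that by (simp add: conjugate_def)
  have c_W: "c w \<in> W" if "w \<in> W" for w using that conj_W t by (simp add: c_def)
  have D_W: "D \<subseteq> W" using c_W by (auto simp: D_def)
  have c_mult: "c (v \<otimes> w) = c v \<otimes> c w" if vw: "v \<in> W" "w \<in> W" for v w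
  proof -
    let ?v = "conjugate t (inv v)" and ?w = "conjugate t (inv w)"
    have m: "?v \<in> W" "?w \<in> W" using vw conj_W t by simp_all
    have "c (v \<otimes> w) = v \<otimes> w \<otimes> (?w \<otimes> ?v)"
      using vw t by (simp add: c_def inv_mult_group conjugate_mult_right)
    also have "\<dots> = v \<otimes> ((w \<otimes> ?w) \<otimes> ?v)" using vw m by (simp add: m_assoc)
    also have "(w \<otimes> ?w) \<otimes> ?v = ?v \<otimes> (w \<otimes> ?w)" using vw m by (intro comm) auto
    finally show ?thesis using vw m by (simp add: c_def m_assoc)
  qed
  have subD: "subgroup D G"
  proof (rule subgroupI)
    show "D \<subseteq> carrier G" using D_W W.subset by blast
    show "D \<noteq> {}" unfolding D_def using W.one_closed by blast
    show "a \<otimes> b \<in> D" if "a \<in> D" "b \<in> D" for a b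
      using that c_mult W.m_closed by (auto simp: D_def simp flip: c_mult)
    show "inv a \<in> D" if a: "a \<in> D" for a
    proof -
      obtain w where w: "w \<in> W" "a = c w" using a unfolding D_def by blast
      have "c (inv w) \<otimes> a = \<one>"
        using w c_mult[of "inv w" w] t by (simp add: c_def)
      moreover have "c (inv w) \<in> W" "a \<in> W" using w c_W by auto
      ultimately have "inv a = c (inv w)" using inv_equality by simp
      then show ?thesis using w by (simp add: D_def)
    qed
  qed
  have t_D: "conjugate t d \<in> D" if d: "d \<in> D" for d
  proof -
    obtain w where w: "w \<in> W" "d = c w" using d unfolding D_def by blast
    then have "conjugate t d = c (conjugate t w)"
      using t by (simp add: c_def conjugate_mult_right conjugate_inv)
    then show ?thesis using conj_W t w by (simp add: D_def)
  qed
  have ti_D: "conjugate (t [^] i) d \<in> D" if "d \<in> D" for d and i :: nat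
    using that
  proof (induction i arbitrary: d)
    case 0
    then have "d \<in> carrier G" using D_W W.subset by blast
    with 0 show ?case by simp
  next
    case (Suc i)
    then have "d \<in> carrier G" using D_W W.subset by blast
    with Suc t_D t show ?case by (simp add: conjugate_mult_left)
  qed
  \<comment> \<open>Conjugation by powers of \<open>t\<close> preserves \<open>D\<close>, and
    elements of \<open>W\<close> centralize \<open>D\<close> because it lies in
    \<open>W\<close>.\<close>
  have normD: "D \<lhd> G"
  proof (rule normal_invI[OF subD])
    fix g d assume g: "g \<in> carrier G" and d: "d \<in> D"
    obtain w and i :: nat where w: "w \<in> W" "g = w \<otimes> t [^] i" using gen g by blast
    let ?e = "conjugate (t [^] i) d"
    have e: "?e \<in> D" by (rule ti_D[OF d])
    then have "?e \<in> W" using D_W by blast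
    then have "conjugate w ?e = ?e" using w comm by (simp add: conjugate_eq_self_iff)
    moreover have "d \<in> carrier G" using d D_W W.subset by blast
    ultimately have "conjugate g d = ?e" using w t by (simp add: conjugate_mult_left)
    then show "g \<otimes> d \<otimes> inv g \<in> D" using e by (simp add: conjugate_def)
  qed
  interpret D: normal D G by (rule normD)
  interpret q: group_hom G "G Mod D" "\<lambda>g. D #> g"
    by (intro group_hom.intro group_hom_axioms.intro is_group D.factorgroup_is_group D.r_coset_hom_Mod)
  have "comm_group (G Mod D)"
  proof (rule q.H.comm_group_of_abelian_and_element[where W = "(\<lambda>w. D #> w) ` W" and t = "D #> t"])
    fix Y assume "Y \<in> carrier (G Mod D)"
    then obtain g where g: "g \<in> carrier G" "Y = D #> g" by (auto simp: carrier_FactGroup)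
    obtain w and i :: nat where w: "w \<in> W" "g = w \<otimes> t [^] i" using gen g by blast
    have "Y = (D #> w) \<otimes>\<^bsub>G Mod D\<^esub> (D #> t) [^]\<^bsub>G Mod D\<^esub> i"
      unfolding g w using w t by (simp only: q.hom_mult q.hom_nat_pow W.mem_carrier nat_pow_closed)
    then show "\<exists>w\<in>(\<lambda>w. D #> w) ` W. \<exists>i::nat. Y = w \<otimes>\<^bsub>G Mod D\<^esub> (D #> t) [^]\<^bsub>G Mod D\<^esub> i"
      using w by blast
  next
    show "(\<lambda>w. D #> w) ` W \<subseteq> carrier (G Mod D)" using W.mem_carrier by (auto simp: carrier_FactGroup)
    show "D #> t \<in> carrier (G Mod D)" using t by (auto simp: carrier_FactGroup)
  next
    fix Y Z assume "Y \<in> (\<lambda>w. D #> w) ` W" "Z \<in> (\<lambda>w. D #> w) ` W"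
    then obtain v w where vw: "v \<in> W" "w \<in> W" "Y = D #> v" "Z = D #> w" by blast
    then have "D #> (v \<otimes> w) = D #> (w \<otimes> v)" using comm by simp
    then show "Y \<otimes>\<^bsub>G Mod D\<^esub> Z = Z \<otimes>\<^bsub>G Mod D\<^esub> Y"
      using vw by (simp only: q.hom_mult W.mem_carrier)
  next
    fix Y assume "Y \<in> (\<lambda>w. D #> w) ` W"
    then obtain w where w: "w \<in> W" "Y = D #> w" by blast
    have wc: "w \<in> carrier G" using w by simp
    have "inv t \<otimes> (t \<otimes> w) = w" using wc t m_assoc[of "inv t" t w] by simp
    then have "c w \<otimes> (t \<otimes> w) = w \<otimes> t"
      using wc t by (simp add: c_def conjugate_def m_assoc)
    then have "D #> (w \<otimes> t) = D #> (c w \<otimes> (t \<otimes> w))" by simp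
    also have "\<dots> = D #> (t \<otimes> w)"
    proof -
      have "c w \<in> D" using w by (simp add: D_def)
      then have "c w \<otimes> (t \<otimes> w) \<in> D #> (t \<otimes> w)" using D.subset w t by (intro rcosI) auto
      then show ?thesis by (rule repr_independence[OF _ m_closed[OF t wc] subD, symmetric])
    qed
    finally show "Y \<otimes>\<^bsub>G Mod D\<^esub> (D #> t) = (D #> t) \<otimes>\<^bsub>G Mod D\<^esub> Y"
      unfolding w using w t by (simp only: q.hom_mult W.mem_carrier)
  qed
  then have "derived G (carrier G) \<subseteq> D" by (rule derived_minimal[OF normD])
  also have "D = (\<lambda>w. commutator G w t) ` W" using c_eq by (auto simp: D_def)
  finally show ?thesis .
qed

section \<open>The center and isoclinism\<close>

lemma group_center_normal: "group_center G \<lhd> G"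
proof (rule normal_invI)
  have eq: "group_center G = carrier G \<inter> (\<Inter>x\<in>carrier G. centralizer x)"
    by (auto simp: group_center_def centralizer_def)
  have "subgroup (\<Inter>(insert (carrier G) (centralizer ` carrier G))) G"
    by (rule subgroups_Inter) (auto simp: subgroup_self subgroup_centralizer)
  then show "subgroup (group_center G) G" by (simp add: eq)
  show "g \<otimes> z \<otimes> inv g \<in> group_center G" if "g \<in> carrier G" "z \<in> group_center G" for g z
  proof -
    have "z \<in> carrier G" "z \<otimes> g = g \<otimes> z" using that by (auto simp: group_center_def)
    then have "g \<otimes> z \<otimes> inv g = z" using that(1) by (metis inv_solve_right' m_closed)
    then show ?thesis using that by simp
  qed
qed

text \<open>Commutators depend only on cosets of the center, which makes the compatibility condition
  in \<open>isoclinic\<close> independent of representatives.\<close>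

lemma commutator_center_mult:
  assumes "z \<in> group_center G" "w \<in> group_center G" "x \<in> carrier G" "y \<in> carrier G"
  shows "commutator G (z \<otimes> x) (w \<otimes> y) = commutator G x y"
proof -
  have car: "z \<in> carrier G" "w \<in> carrier G" using assms by (auto simp: group_center_def)
  have z: "z \<otimes> u = u \<otimes> z" and w: "w \<otimes> u = u \<otimes> w" if "u \<in> carrier G" for u
    using assms that by (auto simp: group_center_def)
  have "commutator G (z \<otimes> x) (w \<otimes> y) = z \<otimes> (x \<otimes> (w \<otimes> y)) \<otimes> inv x \<otimes> inv z \<otimes> inv y \<otimes> inv w"
    using assms car by (simp add: commutator_def inv_mult_group m_assoc)
  also have "\<dots> = x \<otimes> (w \<otimes> y) \<otimes> inv x \<otimes> (z \<otimes> inv z) \<otimes> inv y \<otimes> inv w"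
    using assms car z[of "x \<otimes> (w \<otimes> y) \<otimes> inv x"] by (simp add: m_assoc)
  also have "\<dots> = w \<otimes> (x \<otimes> y) \<otimes> inv x \<otimes> inv y \<otimes> inv w"
    using assms car w[of x] by (simp flip: m_assoc)
  also have "\<dots> = x \<otimes> y \<otimes> inv x \<otimes> inv y \<otimes> (w \<otimes> inv w)"
    using assms car w[of "x \<otimes> y \<otimes> inv x \<otimes> inv y"] by (simp add: m_assoc)
  finally show ?thesis using assms car by (simp add: commutator_def)
qed

end

text \<open>A central element of \<open>G\<close> maps to a central element by surjectivity, and conversely because
  \<open>\<pi>\<close> reflects commutation, so \<open>\<pi>\<close> induces an isomorphism of the central quotients. On the derived
  subgroup \<open>\<pi>\<close> is injective because its elements are commutators.\<close>

lemma isoclinic_if_reflects_commuting: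
  assumes "group_hom G H \<pi>" and surj: "\<pi> ` carrier G = carrier H"
    and reflect: "\<And>x y. x \<in> carrier G \<Longrightarrow> y \<in> carrier G \<Longrightarrow>
      \<pi> x \<otimes>\<^bsub>H\<^esub> \<pi> y = \<pi> y \<otimes>\<^bsub>H\<^esub> \<pi> x \<Longrightarrow> x \<otimes>\<^bsub>G\<^esub> y = y \<otimes>\<^bsub>G\<^esub> x"
    and derived_elem: "\<And>c. c \<in> derived G (carrier G) \<Longrightarrow>
      \<exists>x\<in>carrier G. \<exists>y\<in>carrier G. c = commutator G x y"
  shows "isoclinic G H"
proof -
  interpret group_hom G H \<pi> by fact
  let ?ZG = "group_center G" and ?ZH = "group_center H"
  let ?G' = "derived G (carrier G)" and ?H' = "derived H (carrier H)"
  interpret ZG: normal ?ZG G by (rule G.group_center_normal)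
  interpret ZH: normal ?ZH H by (rule H.group_center_normal)
  \<comment> \<open>The kernel of \<open>q\<close> turns out to be the center of \<open>G\<close>,
    so the first isomorphism theorem gives the map between the central quotients.\<close>
  define q where "q = (\<lambda>g. ?ZH #>\<^bsub>H\<^esub> \<pi> g)"
  have "(\<lambda>a. ?ZH #>\<^bsub>H\<^esub> a) \<circ> \<pi> \<in> hom G (H Mod ?ZH)"
    by (rule Group.hom_compose[OF homh ZH.r_coset_hom_Mod])
  then interpret q: group_hom G "H Mod ?ZH" q
    by (intro group_hom.intro group_hom_axioms.intro G.is_group ZH.factorgroup_is_group)
      (simp add: q_def comp_def)
  have q_surj: "q ` carrier G = carrier (H Mod ?ZH)"
    unfolding carrier_FactGroup surj[symmetric] by (simp add: q_def image_image)
  have center_iff: "\<pi> g \<in> ?ZH \<longleftrightarrow> g \<in> ?ZG" if g: "g \<in> carrier G" for g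
  proof
    assume gZ: "\<pi> g \<in> ?ZH"
    have "g \<otimes>\<^bsub>G\<^esub> x = x \<otimes>\<^bsub>G\<^esub> g" if "x \<in> carrier G" for x
    proof (rule reflect[OF g that])
      show "\<pi> g \<otimes>\<^bsub>H\<^esub> \<pi> x = \<pi> x \<otimes>\<^bsub>H\<^esub> \<pi> g"
        using gZ hom_closed[OF that] unfolding group_center_def by blast
    qed
    then show "g \<in> ?ZG" using g unfolding group_center_def by blast
  next
    assume gZ: "g \<in> ?ZG"
    have "\<pi> g \<otimes>\<^bsub>H\<^esub> y = y \<otimes>\<^bsub>H\<^esub> \<pi> g" if y: "y \<in> carrier H" for y
    proof -
      obtain x where x: "x \<in> carrier G" "y = \<pi> x" using y unfolding surj[symmetric] by blast
      then have "g \<otimes>\<^bsub>G\<^esub> x = x \<otimes>\<^bsub>G\<^esub> g" using gZ unfolding group_center_def by blast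
      then show ?thesis using g x by (simp flip: hom_mult)
    qed
    then show "\<pi> g \<in> ?ZH" using hom_closed[OF g] unfolding group_center_def by blast
  qed
  have "kernel G (H Mod ?ZH) q = ?ZG"
  proof -
    have "q g = ?ZH \<longleftrightarrow> \<pi> g \<in> ?ZH" if "g \<in> carrier G" for g
      using that H.coset_join1[OF _ _ ZH.is_subgroup] H.coset_join2[OF _ ZH.is_subgroup]
      by (auto simp: q_def)
    then show ?thesis using center_iff ZG.subset by (auto simp: kernel_def)
  qed
  then have \<phi>: "(\<lambda>X. the_elem (q ` X)) \<in> iso (G Mod ?ZG) (H Mod ?ZH)"
    using q.FactGroup_iso_set[OF q_surj] by simp
  have \<phi>_coset: "the_elem (q ` (?ZG #>\<^bsub>G\<^esub> g)) = ?ZH #>\<^bsub>H\<^esub> \<pi> g" if g: "g \<in> carrier G" for g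
  proof -
    have "q y = q g" if y: "y \<in> ?ZG #>\<^bsub>G\<^esub> g" for y
    proof -
      obtain z where z: "z \<in> ?ZG" "y = z \<otimes>\<^bsub>G\<^esub> g" using y by (auto simp: r_coset_def)
      then have zc: "z \<in> carrier G" using ZG.subset by blast
      have "\<pi> y \<in> ?ZH #>\<^bsub>H\<^esub> \<pi> g"
        using z zc g center_iff[OF zc] by (auto simp: r_coset_def)
      then show ?thesis
        using H.repr_independence[OF _ _ ZH.is_subgroup] g by (simp add: q_def)
    qed
    moreover have "g \<in> ?ZG #>\<^bsub>G\<^esub> g" by (rule G.rcos_self[OF g ZG.is_subgroup])
    ultimately have "q ` (?ZG #>\<^bsub>G\<^esub> g) = {q g}" by blast
    then show ?thesis by (simp add: q_def)
  qed
  have subG': "subgroup ?G' G" by (rule G.derived_is_subgroup) simp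
  have img: "\<pi> ` ?G' = ?H'" using derived_img[of "carrier G"] surj by simp
  have \<pi>_comm: "\<pi> (commutator G x y) = commutator H (\<pi> x) (\<pi> y)"
    if "x \<in> carrier G" "y \<in> carrier G" for x y
    using that by (simp add: commutator_def)
  have "inj_on \<pi> ?G'"
  proof -
    have triv: "c = \<one>\<^bsub>G\<^esub>" if c: "c \<in> ?G'" "\<pi> c = \<one>\<^bsub>H\<^esub>" for c
    proof -
      obtain x y where xy: "x \<in> carrier G" "y \<in> carrier G" "c = commutator G x y"
        using derived_elem[OF c(1)] by blast
      have "commutator H (\<pi> x) (\<pi> y) = \<one>\<^bsub>H\<^esub>" using \<pi>_comm xy c by simp
      then have "\<pi> x \<otimes>\<^bsub>H\<^esub> \<pi> y \<otimes>\<^bsub>H\<^esub> inv\<^bsub>H\<^esub> (\<pi> y \<otimes>\<^bsub>H\<^esub> \<pi> x) = \<one>\<^bsub>H\<^esub>"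
        using xy by (simp add: commutator_def H.inv_mult_group H.m_assoc)
      then have "\<pi> x \<otimes>\<^bsub>H\<^esub> \<pi> y = \<pi> y \<otimes>\<^bsub>H\<^esub> \<pi> x"
        using xy H.inv_equality[of "\<pi> x \<otimes>\<^bsub>H\<^esub> \<pi> y" "inv\<^bsub>H\<^esub> (\<pi> y \<otimes>\<^bsub>H\<^esub> \<pi> x)"] by simp
      then have eq: "x \<otimes>\<^bsub>G\<^esub> y = y \<otimes>\<^bsub>G\<^esub> x" by (rule reflect[OF xy(1,2)])
      have "c = x \<otimes>\<^bsub>G\<^esub> y \<otimes>\<^bsub>G\<^esub> inv\<^bsub>G\<^esub> (y \<otimes>\<^bsub>G\<^esub> x)"
        using xy by (simp add: commutator_def G.inv_mult_group G.m_assoc)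
      then show ?thesis using xy eq by simp
    qed
    have "kernel (G\<lparr>carrier := ?G'\<rparr>) H \<pi> = {c \<in> ?G'. \<pi> c = \<one>\<^bsub>H\<^esub>}"
      by (simp add: kernel_def)
    also have "\<dots> = {\<one>\<^bsub>G\<^esub>}"
      using triv subgroup.one_closed[OF subG'] hom_one by blast
    finally have "kernel (G\<lparr>carrier := ?G'\<rparr>) H \<pi> = {\<one>\<^bsub>G\<^esub>}" .
    then show ?thesis by (simp add: inj_on_subgroup_iff_trivial_ker[OF subG'])
  qed
  moreover have "\<pi> \<in> hom (G\<lparr>carrier := ?G'\<rparr>) (H\<lparr>carrier := ?H'\<rparr>)"
    using img hom_mult subgroup.mem_carrier[OF subG'] by (auto simp: hom_def)
  ultimately have \<psi>: "\<pi> \<in> iso (G\<lparr>carrier := ?G'\<rparr>) (H\<lparr>carrier := ?H'\<rparr>)"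
    using img by (simp add: iso_def bij_betw_def)
  \<comment> \<open>Any representative \<open>h\<close> of the image coset differs from
    \<open>\<pi> g\<close> by a central factor, which commutators ignore.\<close>
  have lift: "\<exists>z\<in>?ZH. h = z \<otimes>\<^bsub>H\<^esub> \<pi> g"
    if "g \<in> carrier G" "h \<in> carrier H" "the_elem (q ` (?ZG #>\<^bsub>G\<^esub> g)) = ?ZH #>\<^bsub>H\<^esub> h" for g h
  proof -
    have "h \<in> ?ZH #>\<^bsub>H\<^esub> \<pi> g"
      using that \<phi>_coset[OF that(1)] H.rcos_self[OF that(2) ZH.is_subgroup] by simp
    then show ?thesis by (auto simp: r_coset_def)
  qed
  have "\<pi> (commutator G g1 g2) = commutator H h1 h2"
    if g: "g1 \<in> carrier G" "g2 \<in> carrier G" and h: "h1 \<in> carrier H" "h2 \<in> carrier H"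
      and eq: "the_elem (q ` (?ZG #>\<^bsub>G\<^esub> g1)) = ?ZH #>\<^bsub>H\<^esub> h1"
        "the_elem (q ` (?ZG #>\<^bsub>G\<^esub> g2)) = ?ZH #>\<^bsub>H\<^esub> h2" for g1 g2 h1 h2
  proof -
    obtain z1 z2 where "z1 \<in> ?ZH" "h1 = z1 \<otimes>\<^bsub>H\<^esub> \<pi> g1" "z2 \<in> ?ZH" "h2 = z2 \<otimes>\<^bsub>H\<^esub> \<pi> g2"
      using lift[OF g(1) h(1) eq(1)] lift[OF g(2) h(2) eq(2)] by blast
    then show ?thesis using g \<pi>_comm H.commutator_center_mult by simp
  qed
  with \<phi> \<psi> show ?thesis unfolding isoclinic_def by blast
qed

section \<open>Cyclic normal series and quotients\<close>

context group
begin

lemma cyclic_factor: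
  assumes N: "N \<lhd> G" and M: "subgroup M G" and NM: "N \<subseteq> M" and b: "b \<in> M"
    and gen: "\<And>g. g \<in> M \<Longrightarrow> \<exists>k::int. g \<in> N #> b [^] k"
  shows "cyclic_group ((G\<lparr>carrier := M\<rparr>) Mod N)"
proof -
  let ?M = "G\<lparr>carrier := M\<rparr>"
  interpret M: group ?M by (rule subgroup_imp_group[OF M])
  interpret N: normal N ?M by (rule normal_restrict_supergroup[OF M N NM])
  interpret Q: group "?M Mod N" by (rule N.factorgroup_is_group)
  have pow: "N #> b [^] k = (N #> b) [^]\<^bsub>?M Mod N\<^esub> k" for k :: int
  proof -
    have "(N #>\<^bsub>?M\<^esub> b [^]\<^bsub>?M\<^esub> k) = (N #>\<^bsub>?M\<^esub> b) [^]\<^bsub>?M Mod N\<^esub> k"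
      using hom_int_pow[OF N.r_coset_hom_Mod _ M.is_group Q.is_group] b by simp
    then show ?thesis using int_pow_consistent[OF M b] by simp
  qed
  have b': "N #> b \<in> carrier (?M Mod N)" using b by (auto simp: carrier_FactGroup)
  have "carrier (?M Mod N) \<subseteq> range (\<lambda>k::int. (N #> b) [^]\<^bsub>?M Mod N\<^esub> k)"
  proof
    fix X assume "X \<in> carrier (?M Mod N)"
    then obtain g where g: "g \<in> M" "X = N #> g" by (auto simp: carrier_FactGroup)
    obtain k :: int where k: "g \<in> N #> b [^] k" using gen[OF g(1)] by blast
    have "b \<in> carrier G" using b subgroup.mem_carrier[OF M] by blast
    then have "N #> b [^] k = N #> g"
      using k by (intro repr_independence normal_imp_subgroup[OF N]) simp_all
    then show "X \<in> range (\<lambda>k::int. (N #> b) [^]\<^bsub>?M Mod N\<^esub> k)" using g(2) pow by auto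
  qed
  then have "carrier (?M Mod N) = range (\<lambda>k::int. (N #> b) [^]\<^bsub>?M Mod N\<^esub> k)"
    using Q.int_pow_closed[OF b'] by blast
  then show ?thesis unfolding Q.cyclic_group using b' by blast
qed

text \<open>Records only the last term of a series, so that in a finite group a maximal one can be
  chosen and then prolonged by one step.\<close>

inductive cyclic_series :: "'a set \<Rightarrow> bool" where
  trivial: "cyclic_series {\<one>}"
| extend: "cyclic_series N \<Longrightarrow> M \<lhd> G \<Longrightarrow> N \<subseteq> M \<Longrightarrow>
    cyclic_group ((G\<lparr>carrier := M\<rparr>) Mod N) \<Longrightarrow> cyclic_series M"

lemma cyclic_series_normal: "cyclic_series N \<Longrightarrow> N \<lhd> G"
  by (induction rule: cyclic_series.induct) (auto simp: one_is_normal)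

lemma cyclic_series_chain:
  assumes "cyclic_series M"
  shows "\<exists>(n :: nat) N. N 0 = {\<one>} \<and> N n = M \<and> (\<forall>i \<le> n. N i \<lhd> G) \<and>
    (\<forall>i < n. N i \<subseteq> N (Suc i) \<and> cyclic_group ((G\<lparr>carrier := N (Suc i)\<rparr>) Mod (N i)))"
  using assms
proof (induction rule: cyclic_series.induct)
  case trivial
  show ?case by (intro exI[of _ 0] exI[of _ "\<lambda>_. {\<one>}"]) (simp add: one_is_normal)
next
  case (extend N M)
  then obtain n :: nat and f where f: "f 0 = {\<one>}" "f n = N" "\<forall>i \<le> n. f i \<lhd> G"
    "\<forall>i < n. f i \<subseteq> f (Suc i) \<and> cyclic_group ((G\<lparr>carrier := f (Suc i)\<rparr>) Mod (f i))" by blast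
  let ?f = "f(Suc n := M)"
  have "?f 0 = {\<one>}" "?f (Suc n) = M" using f by simp_all
  moreover have "\<forall>i \<le> Suc n. ?f i \<lhd> G" using f(3) extend.hyps(2) by (simp add: le_Suc_eq)
  moreover have "\<forall>i < Suc n. ?f i \<subseteq> ?f (Suc i) \<and>
      cyclic_group ((G\<lparr>carrier := ?f (Suc i)\<rparr>) Mod (?f i))"
    using f(2,4) extend.hyps by (simp add: less_Suc_eq)
  ultimately show ?case by blast
qed

lemma supersolvable_if_cyclic_series: "cyclic_series (carrier G) \<Longrightarrow> supersolvable G"
  unfolding supersolvable_def by (rule cyclic_series_chain)

text \<open>An element \<open>z\<close> conjugate only to itself and its inverse spans a cyclic normal subgroup of the
  quotient, whose preimage prolongs the series.\<close>

lemma cyclic_series_extend: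
  assumes ser: "cyclic_series N" and z: "z \<in> carrier (G Mod N)" "z \<noteq> N"
    and conj: "\<And>g. g \<in> carrier (G Mod N) \<Longrightarrow>
      group.conjugate (G Mod N) g z \<in> {z, inv\<^bsub>G Mod N\<^esub> z}"
  shows "\<exists>M. cyclic_series M \<and> N \<subset> M"
proof -
  interpret N: normal N G by (rule cyclic_series_normal[OF ser])
  interpret Q: group "G Mod N" by (rule N.factorgroup_is_group)
  let ?Q = "G Mod N"
  \<comment> \<open>This is the cyclic group spanned by \<open>z\<close>. The inverse is listed as a
    generator so that the generating set is closed under conjugation.\<close>
  define A where "A = generate ?Q {z, inv\<^bsub>?Q\<^esub> z}"
  have A_normal: "A \<lhd> ?Q"
    unfolding A_def
  proof (rule Q.normal_generateI)
    show "{z, inv\<^bsub>?Q\<^esub> z} \<subseteq> carrier ?Q" using z by simp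
    fix h g assume h: "h \<in> {z, inv\<^bsub>?Q\<^esub> z}" and g: "g \<in> carrier ?Q"
    have "Q.conjugate g (inv\<^bsub>?Q\<^esub> z) = inv\<^bsub>?Q\<^esub> (Q.conjugate g z)"
      by (rule Q.conjugate_inv[OF g z(1)])
    then have "Q.conjugate g h \<in> {z, inv\<^bsub>?Q\<^esub> z}"
      using conj[OF g] h Q.inv_inv[OF z(1)] by (metis insertE insertI1 insertI2 singletonD)
    then show "g \<otimes>\<^bsub>?Q\<^esub> h \<otimes>\<^bsub>?Q\<^esub> inv\<^bsub>?Q\<^esub> g \<in> {z, inv\<^bsub>?Q\<^esub> z}"
      by (simp only: Q.conjugate_def)
  qed
  have A_sub: "subgroup A ?Q" by (rule normal_imp_subgroup[OF A_normal])
  have A_pow: "\<exists>k::int. h = z [^]\<^bsub>?Q\<^esub> k" if h: "h \<in> A" for h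
  proof -
    have sub: "subgroup (generate ?Q {z}) ?Q" using z by (intro Q.generate_is_subgroup) simp
    have "z \<in> generate ?Q {z}" by (rule generate.incl) simp
    then have "A \<subseteq> generate ?Q {z}"
      unfolding A_def using sub by (intro Q.generate_subgroup_incl) (auto simp: subgroup.m_inv_closed)
    then show ?thesis using h Q.generate_pow[OF z(1)] by blast
  qed
  \<comment> \<open>The union of the cosets in \<open>A\<close> is the preimage of \<open>A\<close>
    in \<open>G\<close>.\<close>
  define M where "M = \<Union>A"
  have M_eq: "M = {g \<in> carrier G. N #> g \<in> A}"
    unfolding M_def by (rule N.factgroup_subgroup_union_char[OF A_sub])
  have M_normal: "M \<lhd> G" unfolding M_def by (rule N.factgroup_subgroup_union_normal[OF A_normal])
  obtain b where b: "b \<in> carrier G" "z = N #> b" using z(1) by (auto simp: carrier_FactGroup)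
  have "z \<in> A" unfolding A_def by (rule generate.incl) simp
  then have bM: "b \<in> M" using b by (simp add: M_eq)
  have NM: "N \<subseteq> M"
  proof
    fix a assume "a \<in> N"
    then have "N #> a = N" "a \<in> carrier G" using coset_join2[OF _ N.is_subgroup] by simp_all
    moreover have "N \<in> A" using subgroup.one_closed[OF A_sub] by simp
    ultimately show "a \<in> M" by (simp add: M_eq)
  qed
  have "b \<notin> N" using z(2) b coset_join2[OF _ N.is_subgroup] by blast
  then have "N \<subset> M" using NM bM by blast
  have "cyclic_group ((G\<lparr>carrier := M\<rparr>) Mod N)"
  proof (rule cyclic_factor[OF cyclic_series_normal[OF ser] normal_imp_subgroup[OF M_normal] NM bM])
    fix g assume "g \<in> M"
    then have g: "g \<in> carrier G" "N #> g \<in> A" by (simp_all add: M_eq)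
    obtain k :: int where k: "N #> g = z [^]\<^bsub>?Q\<^esub> k" using A_pow[OF g(2)] by blast
    have "N #> b [^] k = N #> g"
      using hom_int_pow[OF N.r_coset_hom_Mod b(1) is_group Q.is_group, of k] b(2) k by simp
    then have "g \<in> N #> b [^] k" using rcos_self[OF g(1) N.is_subgroup] by simp
    then show "\<exists>k::int. g \<in> N #> b [^] k" by blast
  qed
  then show ?thesis using cyclic_series.extend[OF ser M_normal NM] \<open>N \<subset> M\<close> by blast
qed

text \<open>The class of \<open>y\<close> has at most 2 elements. If it is \<open>{y}\<close>, then
  \<open>y\<close> itself serves. If it is \<open>{y, w}\<close>, conjugation fixes or swaps
  \<open>y\<close> and \<open>w\<close>, hence fixes or inverts
  \<open>y \<otimes> inv w\<close>.\<close>

lemma small_conjugacy_class: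
  assumes fin: "finite (carrier G)" and y: "y \<in> carrier G" "y \<noteq> \<one>"
    and small: "order G < 3 * card (centralizer y)"
  shows "\<exists>z\<in>carrier G. z \<noteq> \<one> \<and> (\<forall>g\<in>carrier G. conjugate g z \<in> {z, inv z})"
proof -
  have "card (conjugacy_class y) * card (centralizer y) < 3 * card (centralizer y)"
    using small card_conjugacy_class[OF y(1)] by simp
  then have le: "card (conjugacy_class y) \<le> 2" by (metis mult_less_cancel2 less_Suc_eq_le numeral_3_eq_3 numeral_2_eq_2)
  have finc: "finite (conjugacy_class y)" using fin by (simp add: conjugacy_class_def)
  have conj: "conjugate g u \<in> conjugacy_class y" if "g \<in> carrier G" "u \<in> conjugacy_class y" for g u
    using conjugate_mem_conjugacy_class[OF that(1) y(1) that(2)] .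
  show ?thesis
  proof (cases "conjugacy_class y = {y}")
    case True
    then show ?thesis using conj y by blast
  next
    case False
    then obtain w where w: "w \<in> conjugacy_class y" "w \<noteq> y"
      using conjugacy_class_self[OF y(1)] by blast
    have cls: "conjugacy_class y = {y, w}"
      using card_seteq[OF finc, of "{y, w}"] w conjugacy_class_self[OF y(1)] le by simp
    have wc: "w \<in> carrier G" using w conjugacy_class_subset[OF y(1)] by blast
    have "y \<otimes> inv w \<noteq> \<one>" using w y wc by (metis inv_closed inv_equality inv_inv)
    moreover have "conjugate g (y \<otimes> inv w) \<in> {y \<otimes> inv w, inv (y \<otimes> inv w)}" if g: "g \<in> carrier G" for g
    proof -
      have "conjugate g y \<in> {y, w}" "conjugate g w \<in> {y, w}" "conjugate g y \<noteq> conjugate g w"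
        using conj[OF g] g y wc w cls by auto
      then have "conjugate g y = y \<and> conjugate g w = w \<or> conjugate g y = w \<and> conjugate g w = y"
        by auto
      then show ?thesis
        using g y wc by (auto simp: conjugate_mult_right conjugate_inv inv_mult_group)
    qed
    ultimately show ?thesis using y wc by blast
  qed
qed

end

section \<open>Counting commuting pairs through a quotient\<close>

lemma (in normal) card_preimage_pairs:
  assumes fin: "finite (carrier G)" and S: "S \<subseteq> carrier (G Mod H) \<times> carrier (G Mod H)"
  shows "card {(x, y). x \<in> carrier G \<and> y \<in> carrier G \<and> (H #> x, H #> y) \<in> S} = (card H)\<^sup>2 * card S"
proof -
  let ?P = "\<lambda>(X, Y). X \<times> Y"
  have carr: "carrier (G Mod H) = rcosets H" by (simp add: FactGroup_def)
  have cosets: "X = H #> x \<longleftrightarrow> x \<in> X" if X: "X \<in> rcosets H" and xc: "x \<in> carrier G" for X x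
  proof
    assume "X = H #> x" then show "x \<in> X" using rcos_self[OF xc is_subgroup] by simp
  next
    assume x: "x \<in> X"
    obtain a where "a \<in> carrier G" "X = H #> a" using X by (auto simp: RCOSETS_def)
    then show "X = H #> x" using repr_independence[OF _ _ is_subgroup] x by blast
  qed
  have in_carr: "X \<subseteq> carrier G" if "X \<in> rcosets H" for X
    using rcosets_carrier[OF is_group that] .
  have "{(x, y). x \<in> carrier G \<and> y \<in> carrier G \<and> (H #> x, H #> y) \<in> S} = (\<Union>p\<in>S. ?P p)"
  proof (rule equalityI; rule subsetI)
    fix p assume "p \<in> {(x, y). x \<in> carrier G \<and> y \<in> carrier G \<and> (H #> x, H #> y) \<in> S}"
    then obtain x y where xy: "p = (x, y)" "x \<in> carrier G" "y \<in> carrier G" "(H #> x, H #> y) \<in> S"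
      by blast
    then have "p \<in> (H #> x) \<times> (H #> y)" using rcos_self[OF _ is_subgroup] by simp
    then show "p \<in> (\<Union>p\<in>S. ?P p)" using xy(4) by blast
  next
    fix p assume "p \<in> (\<Union>p\<in>S. ?P p)"
    then obtain X Y where XY: "(X, Y) \<in> S" "p \<in> X \<times> Y" by blast
    then have r: "X \<in> rcosets H" "Y \<in> rcosets H" using S carr by auto
    have p: "fst p \<in> X" "snd p \<in> Y" using XY(2) by auto
    then have pc: "fst p \<in> carrier G" "snd p \<in> carrier G" using r in_carr by blast+
    then have "H #> fst p = X" "H #> snd p = Y" using cosets r p by metis+
    with pc show "p \<in> {(x, y). x \<in> carrier G \<and> y \<in> carrier G \<and> (H #> x, H #> y) \<in> S}"
      using XY(1) by (auto simp: case_prod_beta)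
  qed
  moreover have "card (\<Union>p\<in>S. ?P p) = (\<Sum>p\<in>S. card (?P p))"
  proof (rule card_UN_disjoint)
    have "finite (rcosets H)" using fin by (simp add: RCOSETS_def)
    then show "finite S" using S unfolding carr by (meson finite_SigmaI finite_subset)
    show "\<forall>p\<in>S. finite (?P p)"
    proof
      fix p assume "p \<in> S"
      then have "fst p \<in> rcosets H" "snd p \<in> rcosets H" using S carr by auto
      then have "finite (fst p)" "finite (snd p)" using in_carr fin finite_subset by metis+
      then show "finite (?P p)" by (simp add: case_prod_beta)
    qed
    show "\<forall>p\<in>S. \<forall>q\<in>S. p \<noteq> q \<longrightarrow> ?P p \<inter> ?P q = {}"
    proof (intro ballI impI)
      fix p q assume pq: "p \<in> S" "q \<in> S" "p \<noteq> q"
      then have r: "fst p \<in> rcosets H" "snd p \<in> rcosets H" "fst q \<in> rcosets H" "snd q \<in> rcosets H"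
        using S carr by auto
      have "X = Y" if "X \<in> rcosets H" "Y \<in> rcosets H" "x \<in> X" "x \<in> Y" for X Y x
        using cosets[OF that(1), of x] cosets[OF that(2), of x] in_carr[OF that(1)] that(3,4) by blast
      from this[OF r(1,3)] this[OF r(2,4)] show "?P p \<inter> ?P q = {}"
        using pq(3) by (auto simp: case_prod_beta prod_eq_iff)
    qed
  qed
  moreover have "card (?P p) = (card H)\<^sup>2" if "p \<in> S" for p
  proof -
    have "fst p \<in> rcosets H" "snd p \<in> rcosets H" using that S carr by auto
    then have "card (fst p) = card H" "card (snd p) = card H"
      using card_rcosets_equal[OF _ subset] by metis+
    then show ?thesis by (simp add: case_prod_beta card_cartesian_product power2_eq_square)
  qed
  ultimately show ?thesis by (simp add: mult.commute)
qed

text \<open>Commuting pairs of \<open>G\<close> lie in the preimage of the commuting pairs of the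
  quotient, whose size is given by \<open>card_preimage_pairs\<close>. If the cardinalities agree,
  these finite sets coincide, so commutation in the quotient is reflected in
  \<open>G\<close>.\<close>

lemma (in group) commuting_pairs_quotient:
  assumes N: "N \<lhd> G" and fin: "finite (carrier G)"
  shows "card commuting_pairs \<le> (card N)\<^sup>2 * card (group.commuting_pairs (G Mod N))"
    and "card commuting_pairs = (card N)\<^sup>2 * card (group.commuting_pairs (G Mod N)) \<Longrightarrow>
      x \<in> carrier G \<Longrightarrow> y \<in> carrier G \<Longrightarrow>
      (N #> x) \<otimes>\<^bsub>G Mod N\<^esub> (N #> y) = (N #> y) \<otimes>\<^bsub>G Mod N\<^esub> (N #> x) \<Longrightarrow> x \<otimes> y = y \<otimes> x"
proof -
  interpret N: normal N G by (rule N)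
  interpret Q: group "G Mod N" by (rule N.factorgroup_is_group)
  interpret q: group_hom G "G Mod N" "\<lambda>g. N #> g"
    by (intro group_hom.intro group_hom_axioms.intro is_group Q.is_group N.r_coset_hom_Mod)
  let ?P = "{(x, y). x \<in> carrier G \<and> y \<in> carrier G \<and> (N #> x, N #> y) \<in> Q.commuting_pairs}"
  have card_P: "card ?P = (card N)\<^sup>2 * card Q.commuting_pairs"
    by (rule N.card_preimage_pairs[OF fin]) (auto simp: Q.commuting_pairs_def)
  have sub: "commuting_pairs \<subseteq> ?P"
  proof
    fix p assume "p \<in> commuting_pairs"
    then obtain x y where xy: "p = (x, y)" "x \<in> carrier G" "y \<in> carrier G" "x \<otimes> y = y \<otimes> x"
      by (auto simp: commuting_pairs_def)
    then have "(N #> x, N #> y) \<in> Q.commuting_pairs"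
      unfolding Q.commuting_pairs_def using q.hom_mult[of x y] q.hom_mult[of y x] q.hom_closed
      by simp
    then show "p \<in> ?P" using xy by simp
  qed
  have "?P \<subseteq> carrier G \<times> carrier G" by auto
  then have fin_P: "finite ?P" using fin by (meson finite_SigmaI finite_subset)
  show "card commuting_pairs \<le> (card N)\<^sup>2 * card Q.commuting_pairs"
    using card_mono[OF fin_P sub] card_P by simp
  assume "card commuting_pairs = (card N)\<^sup>2 * card Q.commuting_pairs"
  then have eq: "commuting_pairs = ?P" using card_subset_eq[OF fin_P sub] card_P by simp
  assume xy: "x \<in> carrier G" "y \<in> carrier G"
    and comm: "(N #> x) \<otimes>\<^bsub>G Mod N\<^esub> (N #> y) = (N #> y) \<otimes>\<^bsub>G Mod N\<^esub> (N #> x)"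
  have "(x, y) \<in> ?P"
    using xy comm q.hom_closed by (simp add: Q.commuting_pairs_def del: mult_FactGroup)
  then show "x \<otimes> y = y \<otimes> x" unfolding eq[symmetric] by (simp add: commuting_pairs_def)
qed

section \<open>The quotient by a maximal cyclic series\<close>

lemma (in group) supersolvable_or_isoclinic:
  assumes fin: "finite (carrier G)" and cp: "commuting_probability G \<ge> 1 / 3"
  shows "supersolvable G \<or> isoclinic G (alt_group 4)"
proof -
  have "0 < order G" using fin by (simp add: order_gt_0_iff_finite)
  then have "real ((order G)\<^sup>2) \<le> real (3 * card commuting_pairs)"
    using cp by (simp add: commuting_probability_def commuting_pairs_def field_simps)
  then have prob: "(order G)\<^sup>2 \<le> 3 * card commuting_pairs" by (simp only: of_nat_le_iff)
  have "{N. cyclic_series N} \<subseteq> Pow (carrier G)"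
    using cyclic_series_normal normal_imp_subgroup subgroup.subset by blast
  then have "finite {N. cyclic_series N}" using fin by (meson finite_Pow_iff finite_subset)
  moreover have "{N. cyclic_series N} \<noteq> {}" using cyclic_series.trivial by blast
  ultimately obtain N where ser: "cyclic_series N"
    and maximal: "\<And>M. cyclic_series M \<Longrightarrow> N \<subseteq> M \<Longrightarrow> N = M"
    using finite_has_maximal[of "{N. cyclic_series N}"] by blast
  show ?thesis
  proof (cases "N = carrier G")
    case True
    then show ?thesis using supersolvable_if_cyclic_series ser by simp
  next
    case False
    let ?Q = "G Mod N"
    interpret N: normal N G by (rule cyclic_series_normal[OF ser])
    interpret Q: group ?Q by (rule N.factorgroup_is_group)
    interpret q: group_hom G ?Q "\<lambda>g. N #> g"
      by (intro group_hom.intro group_hom_axioms.intro is_group Q.is_group N.r_coset_hom_Mod)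
    have q_surj: "(\<lambda>g. N #> g) ` carrier G = carrier ?Q" by (simp add: carrier_FactGroup)
    have fin_N: "finite N" using fin N.subset finite_subset by blast
    then have card_N: "0 < card N" using N.one_closed card_gt_0_iff by blast
    have order_Q: "order ?Q * card N = order G"
      using lagrange[OF N.is_subgroup] by (simp add: order_def FactGroup_def)
    note le = commuting_pairs_quotient(1)[OF N.normal_axioms fin]
    interpret Q: small_centralizers ?Q
    proof unfold_locales
      show fin_Q: "finite (carrier ?Q)" using fin by (simp add: carrier_FactGroup)
      show "3 * card (Q.centralizer y) \<le> order ?Q" if y: "y \<in> carrier ?Q" "y \<noteq> \<one>\<^bsub>?Q\<^esub>" for y
      proof (rule ccontr)
        assume "\<not> 3 * card (Q.centralizer y) \<le> order ?Q"
        \<comment> \<open>Too large a centralizer would give an element that prolongs the series,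
          against the maximality of \<open>N\<close>.\<close>
        then obtain z where "z \<in> carrier ?Q" "z \<noteq> N"
          "\<And>g. g \<in> carrier ?Q \<Longrightarrow> Q.conjugate g z \<in> {z, inv\<^bsub>?Q\<^esub> z}"
          using Q.small_conjugacy_class[OF fin_Q y] by auto
        then show False using cyclic_series_extend[OF ser] maximal by blast
      qed
      have "(order ?Q)\<^sup>2 * (card N)\<^sup>2 = (order G)\<^sup>2"
        unfolding order_Q[symmetric] by (rule power_mult_distrib[symmetric])
      also have "\<dots> \<le> 3 * ((card N)\<^sup>2 * card Q.commuting_pairs)"
        using prob le by linarith
      also have "\<dots> = 3 * card Q.commuting_pairs * (card N)\<^sup>2" by simp
      finally show "(order ?Q)\<^sup>2 \<le> 3 * card Q.commuting_pairs" using card_N by simp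
    qed
    have "order ?Q \<noteq> 1"
      using order_Q False card_subset_eq[OF fin N.subset] by (auto simp: order_def)
    then have nontriv: "1 < order ?Q" using Q.order_pos by linarith
    note Q_struct = Q.alternating_structure[OF nontriv]
    \<comment> \<open>The commuting probability of the quotient is exactly 1/3, and that of
      \<open>G\<close> lies between 1/3 and this value; so equality holds and \<open>G\<close>
      reflects commutation in the quotient.\<close>
    have "3 * ((card N)\<^sup>2 * card Q.commuting_pairs) = (order G)\<^sup>2"
      using Q_struct(1) by (simp add: power_mult_distrib flip: order_Q)
    then have "card commuting_pairs = (card N)\<^sup>2 * card Q.commuting_pairs"
      using prob le by linarith
    note reflect = commuting_pairs_quotient(2)[OF N.normal_axioms fin this]
    obtain \<pi> where iso: "\<pi> \<in> iso ?Q (alt_group 4)" using Q_struct(2) by blast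
    obtain V T where V: "V \<lhd> ?Q" and T: "T \<in> carrier ?Q"
      and V_comm: "\<forall>v\<in>V. \<forall>w\<in>V. v \<otimes>\<^bsub>?Q\<^esub> w = w \<otimes>\<^bsub>?Q\<^esub> v"
      and gen: "\<forall>g\<in>carrier ?Q. \<exists>w\<in>V. \<exists>i::nat. g = w \<otimes>\<^bsub>?Q\<^esub> T [^]\<^bsub>?Q\<^esub> i"
      using Q_struct(3) by blast
    obtain t where t: "t \<in> carrier G" "T = N #> t" using T by (auto simp: carrier_FactGroup)
    define W where "W = \<Union>V"
    have W_eq: "W = {g \<in> carrier G. N #> g \<in> V}"
      unfolding W_def by (rule N.factgroup_subgroup_union_char[OF normal_imp_subgroup[OF V]])
    have W: "W \<lhd> G" unfolding W_def by (rule N.factgroup_subgroup_union_normal[OF V])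
    \<comment> \<open>The preimage of an abelian subgroup would in general be only abelian modulo
      \<open>N\<close>; reflection makes it abelian.\<close>
    have W_comm: "v \<otimes> w = w \<otimes> v" if "v \<in> W" "w \<in> W" for v w
    proof (rule reflect)
      show "v \<in> carrier G" "w \<in> carrier G" using that by (simp_all add: W_eq)
      show "(N #> v) \<otimes>\<^bsub>?Q\<^esub> (N #> w) = (N #> w) \<otimes>\<^bsub>?Q\<^esub> (N #> v)"
        using V_comm that unfolding W_eq by blast
    qed
    have W_gen: "\<exists>w\<in>W. \<exists>i::nat. g = w \<otimes> t [^] i" if g: "g \<in> carrier G" for g
    proof -
      obtain v and i :: nat where v: "v \<in> V" "N #> g = v \<otimes>\<^bsub>?Q\<^esub> T [^]\<^bsub>?Q\<^esub> i"
        using gen q.hom_closed[OF g] by blast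
      have vc: "v \<in> carrier ?Q" using v(1) subgroup.mem_carrier[OF normal_imp_subgroup[OF V]] by blast
      have Ti: "T [^]\<^bsub>?Q\<^esub> i = N #> t [^] i" using q.hom_nat_pow[OF t(1)] t(2) by simp
      have tc: "t [^] i \<in> carrier G" using t(1) by simp
      \<comment> \<open>Removing the power of \<open>t\<close> from \<open>g\<close> leaves an
        element whose coset is \<open>v\<close>, so it lies in the preimage
        \<open>W\<close>.\<close>
      define w where "w = g \<otimes> inv (t [^] i)"
      have wc: "w \<in> carrier G" using g tc by (simp add: w_def)
      have w: "g = w \<otimes> t [^] i" using g tc by (simp add: w_def m_assoc)
      then have "(N #> w) \<otimes>\<^bsub>?Q\<^esub> (N #> t [^] i) = v \<otimes>\<^bsub>?Q\<^esub> (N #> t [^] i)"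
        using v(2) q.hom_mult[OF wc tc] Ti by metis
      then have "N #> w = v" using Q.right_cancel[OF q.hom_closed[OF tc] q.hom_closed[OF wc] vc] by blast
      then show ?thesis using w wc v(1) unfolding W_eq by blast
    qed
    let ?\<pi> = "\<lambda>g. \<pi> (N #> g)"
    have "isoclinic G (alt_group 4)"
    proof (rule isoclinic_if_reflects_commuting)
      have "\<pi> \<circ> (\<lambda>g. N #> g) \<in> hom G (alt_group 4)"
        using iso by (intro Group.hom_compose[OF N.r_coset_hom_Mod]) (simp add: iso_def)
      then show "group_hom G (alt_group 4) ?\<pi>"
        by (intro group_hom.intro group_hom_axioms.intro is_group alt_group_is_group)
          (simp add: comp_def)
      have "?\<pi> ` carrier G = \<pi> ` (\<lambda>g. N #> g) ` carrier G" by (simp only: image_image)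
      then show "?\<pi> ` carrier G = carrier (alt_group 4)"
        using iso q_surj by (simp add: iso_def bij_betw_def)
    next
      fix x y assume xy: "x \<in> carrier G" "y \<in> carrier G"
        and eq: "?\<pi> x \<otimes>\<^bsub>alt_group 4\<^esub> ?\<pi> y = ?\<pi> y \<otimes>\<^bsub>alt_group 4\<^esub> ?\<pi> x"
      note xyQ = q.hom_closed[OF xy(1)] q.hom_closed[OF xy(2)]
      have hom: "\<pi> \<in> hom ?Q (alt_group 4)" and inj: "inj_on \<pi> (carrier ?Q)"
        using iso by (auto simp: iso_def bij_betw_def)
      have "\<pi> ((N #> x) \<otimes>\<^bsub>?Q\<^esub> (N #> y)) = \<pi> ((N #> y) \<otimes>\<^bsub>?Q\<^esub> (N #> x))"
        using eq hom_mult[OF hom] xyQ by metis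
      then have "(N #> x) \<otimes>\<^bsub>?Q\<^esub> (N #> y) = (N #> y) \<otimes>\<^bsub>?Q\<^esub> (N #> x)"
        using inj_onD[OF inj] Q.m_closed xyQ by blast
      then show "x \<otimes> y = y \<otimes> x" by (rule reflect[OF xy])
    next
      fix c assume "c \<in> derived G (carrier G)"
      then obtain w where "w \<in> W" "c = commutator G w t"
        using derived_subset_commutators[OF W W_comm t(1) W_gen] by blast
      then show "\<exists>x\<in>carrier G. \<exists>y\<in>carrier G. c = commutator G x y"
        using t(1) unfolding W_eq by blast
    qed
    then show ?thesis ..
  qed
qed

theorem corollary2:
  fixes G :: "('a, 'b) monoid_scheme"
  assumes "group G"
    and "finite (carrier G)"
    and "commuting_probability G \<ge> 1 / 3"
  shows "supersolvable G \<or> isoclinic G (alt_group 4)"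
  using assms by (rule group.supersolvable_or_isoclinic)

end
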